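(* Every $L^1$ derivative-pair tester for monotonicity of $M$-Lipschitz functions $f:[0,1]^d\to\mathbb{R}$ must have query complexity $\Omega\left(\frac{\sqrt{d}\,M}{\epsilon}\right)$.
   Context: $f$ is $M$-Lipschitz if $|f(x)-f(y)|\le M|x-y|$ (Euclidean norm). $x\preceq y$ means $x_i\le y_i$ for all $i$; $g$ is monotone if $g(x)\le g(y)$ whenever $x\preceq y$. $\mathsf{dist}^{\mathsf{mono}}_1(f)=\inf\{\|f-g\|_{L^1([0,1]^d)}: g \text{ monotone}\}$. An $L^1$ monotonicity tester for $M$-Lipschitz functions (parameters $d,M,\epsilon$) must accept every monotone $M$-Lipschitz $f$ with probability $\ge 2/3$ and reject every $M$-Lipschitz $f$ with $\mathsf{dist}^{\mathsf{mono}}_1(f)\ge\epsilon$ with probability $\ge 2/3$. A derivative-pair tester is described by a distribution $\mathcal{D}$ over pair tests and directional derivative tests: a pair test performs value queries $f(x),f(y)$ for some $x\preceq y$ and rejects iff $f(x)>f(y)$; a directional derivative test queries the directional derivative $v\cdot\nabla f(x)$ at a point $x$ in a direction $v\succeq 0$ and rejects iff $v\cdot\nabla f(x)<0$. The tester samples $m$ tests independently from $\mathcal{D}$, rejects if any test rejects and accepts otherwise; its query complexity is the number of queries made.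
   Formalization: The bound is stated for ε ≤ c₀M and M/ε ≤ exp(Kd), for any K, with the Ω-constant depending only on K; without such limits it fails (for d = 1, O(√(M/ε) log(M/ε)) pair tests suffice as ε → 0, and for large ε/M no function is ε-far). *)

theory Defs
  imports "HOL-Probability.Probability"
begin

text \<open>
  The constant hidden in \<open>\<Omega>\<close> must not depend on the dimension, so \<open>d\<close> is a natural number
  quantified inside the statement rather than a type.  Points of \<open>[0,1]\<^sup>d\<close> are functions on
  \<open>{..<d}\<close>, extended by \<open>undefined\<close> as usual for \<open>PiE\<close> (so that the cube is the space of a
  product measure).
\<close>

definition cube :: "nat \<Rightarrow> (nat \<Rightarrow> real) set" where
  "cube d = (\<Pi>\<^sub>E i\<in>{..<d}. {0..1})"

definition eucl_dist :: "nat \<Rightarrow> (nat \<Rightarrow> real) \<Rightarrow> (nat \<Rightarrow> real) \<Rightarrow> real" where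
  "eucl_dist d x y = L2_set (\<lambda>i. x i - y i) {..<d}"

definition coord_le :: "nat \<Rightarrow> (nat \<Rightarrow> real) \<Rightarrow> (nat \<Rightarrow> real) \<Rightarrow> bool" where
  "coord_le d x y \<longleftrightarrow> (\<forall>i<d. x i \<le> y i)"

definition lipschitz_cube :: "nat \<Rightarrow> real \<Rightarrow> ((nat \<Rightarrow> real) \<Rightarrow> real) \<Rightarrow> bool" where
  "lipschitz_cube d M f \<longleftrightarrow> (\<forall>x\<in>cube d. \<forall>y\<in>cube d. \<bar>f x - f y\<bar> \<le> M * eucl_dist d x y)"

definition monotone_cube :: "nat \<Rightarrow> ((nat \<Rightarrow> real) \<Rightarrow> real) \<Rightarrow> bool" where
  "monotone_cube d g \<longleftrightarrow> (\<forall>x\<in>cube d. \<forall>y\<in>cube d. coord_le d x y \<longrightarrow> g x \<le> g y)"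

text \<open>
  Lebesgue measure on the cube.  The completion matters: for \<open>d \<ge> 2\<close> a monotone function is
  Lebesgue measurable but need not be Borel measurable.
\<close>

definition cube_measure :: "nat \<Rightarrow> (nat \<Rightarrow> real) measure" where
  "cube_measure d = completion (\<Pi>\<^sub>M i\<in>{..<d}. restrict_space lborel {0..1})"

text \<open>
  Integrability of \<open>g\<close> excludes no monotone function (these are bounded and Lebesgue measurable
  on the cube); it makes explicit that the Bochner integral below is not a default value.
\<close>

definition dist_mono1 :: "nat \<Rightarrow> ((nat \<Rightarrow> real) \<Rightarrow> real) \<Rightarrow> real" where
  "dist_mono1 d f =
     Inf {(\<integral>x. \<bar>f x - g x\<bar> \<partial>cube_measure d) | g.
            monotone_cube d g \<and> integrable (cube_measure d) g}"

text \<open>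
  Differentiability at \<open>x\<close> relative to the cube, with gradient \<open>p\<close>.  As the cube is convex with
  nonempty interior, the entries \<open>p i\<close>, \<open>i < d\<close>, are unique, also at boundary points.
\<close>

definition has_gradient ::
    "nat \<Rightarrow> ((nat \<Rightarrow> real) \<Rightarrow> real) \<Rightarrow> (nat \<Rightarrow> real) \<Rightarrow> (nat \<Rightarrow> real) \<Rightarrow> bool" where
  "has_gradient d f x p \<longleftrightarrow>
     (\<forall>e>0. \<exists>r>0. \<forall>y\<in>cube d. eucl_dist d y x < r \<longrightarrow>
        \<bar>f y - f x - (\<Sum>i<d. p i * (y i - x i))\<bar> \<le> e * eucl_dist d y x)"

datatype mono_test =
    Pair_Test "nat \<Rightarrow> real" "nat \<Rightarrow> real"    \<comment> \<open>value queries at \<open>x\<close> and \<open>y\<close>\<close>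
  | Deriv_Test "nat \<Rightarrow> real" "nat \<Rightarrow> real"   \<comment> \<open>point \<open>x\<close>, direction \<open>v\<close>\<close>

fun legal_test :: "nat \<Rightarrow> mono_test \<Rightarrow> bool" where
  "legal_test d (Pair_Test x y) \<longleftrightarrow> x \<in> cube d \<and> y \<in> cube d \<and> coord_le d x y"
| "legal_test d (Deriv_Test x v) \<longleftrightarrow> x \<in> cube d \<and> (\<forall>i<d. 0 \<le> v i)"

text \<open>
  A Lipschitz function need not be differentiable everywhere; a directional derivative test at a
  point where \<open>\<nabla>f\<close> does not exist does not reject.
\<close>

fun test_rejects :: "nat \<Rightarrow> ((nat \<Rightarrow> real) \<Rightarrow> real) \<Rightarrow> mono_test \<Rightarrow> bool" where
  "test_rejects d f (Pair_Test x y) \<longleftrightarrow> f x > f y"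
| "test_rejects d f (Deriv_Test x v) \<longleftrightarrow>
     (\<exists>p. has_gradient d f x p \<and> (\<Sum>i<d. v i * p i) < 0)"

fun test_queries :: "mono_test \<Rightarrow> nat" where
  "test_queries (Pair_Test x y) = 2"
| "test_queries (Deriv_Test x v) = 1"

text \<open>
  A distribution over tests.  No particular sigma-algebra on tests is imposed, only that for each
  admissible input the rejection event has a probability; this covers discrete distributions as
  well as Borel distributions on the parameters of the tests.
\<close>

definition test_distribution :: "nat \<Rightarrow> real \<Rightarrow> mono_test measure \<Rightarrow> bool" where
  "test_distribution d M D \<longleftrightarrow>
     prob_space D \<and>
     (\<forall>t\<in>space D. legal_test d t) \<and>
     (\<forall>f. lipschitz_cube d M f \<longrightarrow> {t \<in> space D. test_rejects d f t} \<in> sets D)"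

text \<open>\<open>m\<close> independent samples from \<open>D\<close>.\<close>

definition samples :: "nat \<Rightarrow> mono_test measure \<Rightarrow> (nat \<Rightarrow> mono_test) measure" where
  "samples m D = (\<Pi>\<^sub>M i\<in>{..<m}. D)"

definition accept_prob :: "nat \<Rightarrow> nat \<Rightarrow> mono_test measure \<Rightarrow> ((nat \<Rightarrow> real) \<Rightarrow> real) \<Rightarrow> real" where
  "accept_prob d m D f =
     measure (samples m D) {\<omega> \<in> space (samples m D). \<forall>i<m. \<not> test_rejects d f (\<omega> i)}"

definition reject_prob :: "nat \<Rightarrow> nat \<Rightarrow> mono_test measure \<Rightarrow> ((nat \<Rightarrow> real) \<Rightarrow> real) \<Rightarrow> real" where
  "reject_prob d m D f =
     measure (samples m D) {\<omega> \<in> space (samples m D). \<exists>i<m. test_rejects d f (\<omega> i)}"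

definition L1_derivative_pair_tester ::
    "nat \<Rightarrow> real \<Rightarrow> real \<Rightarrow> nat \<Rightarrow> mono_test measure \<Rightarrow> bool" where
  "L1_derivative_pair_tester d M \<epsilon> m D \<longleftrightarrow>
     test_distribution d M D \<and>
     (\<forall>f. lipschitz_cube d M f \<and> monotone_cube d f \<longrightarrow> accept_prob d m D f \<ge> 2/3) \<and>
     (\<forall>f. lipschitz_cube d M f \<and> dist_mono1 d f \<ge> \<epsilon> \<longrightarrow> reject_prob d m D f \<ge> 2/3)"

text \<open>Worst-case number of queries over the outcomes of the sampling.\<close>

definition query_complexity :: "nat \<Rightarrow> mono_test measure \<Rightarrow> nat" where
  "query_complexity m D = (SUP \<omega>\<in>space (samples m D). \<Sum>i<m. test_queries (\<omega> i))"

end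

(*
  Fix a secret coordinate i.  The hard function is increasing with slope M/(4 sqrt d) in every other
  coordinate and falls by at most M w / 2 while x_i crosses a secret interval of length w.  A pair
  x <= y with y - x = h detects the fall only if h_i is at least about (sum_j h_j) / sqrt d, which holds
  for at most O(sqrt d) coordinates i, and only if [x_i, y_i] meets the secret interval; averaging over
  i and the position of the interval, a pair is successful with probability O(w / sqrt d) provided
  w >= rho / sqrt d.  Reflecting x_i shows that the L1 distance to monotonicity is of order M w, so
  w = 8 eps / M settles the case M / eps = O(sqrt d).  For smaller eps take w of order 1 / sqrt d
  and switch the fall on only inside an l1 ball of volume delta about a random point of the torus, in
  the coordinates other than i: both the distance and the success probability scale with delta.
  The ball has radius of order d because delta >= exp (- K d), so its radius can be multiplied by
  1 + O(1/d), which multiplies its volume by O(1), while the amplitude M w / 2 is reached with slopes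
  at most M / (8 sqrt d); these do not destroy monotonicity in the other coordinates.
  All secrets range over finite sets because the sigma-algebra on tests is arbitrary: only rejection
  events of single functions are measurable, so Fubini is not available for a continuous family.
*)
theory Submission
  imports Defs
begin

section \<open>Volumes of balls in the torus\<close>

abbreviation unit_measure :: "real measure" where
  "unit_measure \<equiv> restrict_space lborel {0..1}"

lemma prob_space_unit_measure: "prob_space unit_measure"
  by (rule prob_spaceI) (simp add: emeasure_restrict_space space_restrict_space)

interpretation unit: prob_space unit_measure
  by (rule prob_space_unit_measure)

interpretation unit_prod: product_sigma_finite "\<lambda>_::nat. unit_measure"
  by standard

lemma space_unit_measure [simp]: "space unit_measure = {0..1}"
  by (simp add: space_restrict_space)

lemma nn_integral_unit_measure:
  "(\<integral>\<^sup>+u. F u \<partial>unit_measure) = (\<integral>\<^sup>+u. F u * indicator {0..1} u \<partial>lborel)"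
  by (rule nn_integral_restrict_space) auto

lemma borel_measurable_unit_measure [measurable (raw)]:
  "f \<in> borel_measurable borel \<Longrightarrow> f \<in> borel_measurable unit_measure"
  by (intro measurable_restrict_space1) simp

lemma AE_lborel_neq: "AE u in lborel. u \<noteq> (c::real)"
proof -
  have "{c} \<in> null_sets lborel" by (simp add: null_sets_def)
  then show ?thesis by (rule AE_I') auto
qed

section \<open>The circle of length one and volumes of l1 balls\<close>

text \<open>The formula is 1-Lipschitz on the whole line, so that \<open>amplitude\<close> can
  quantify over all points and not only over the cube.\<close>

definition tri :: "real \<Rightarrow> real" where
  "tri u = min \<bar>u\<bar> (1 - \<bar>u\<bar>)"

lemma tri_borel [measurable]: "tri \<in> borel_measurable borel"
  unfolding tri_def[abs_def] by measurable

lemma tri_lipschitz: "\<bar>tri u - tri v\<bar> \<le> \<bar>u - v\<bar>"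
  unfolding tri_def by linarith

lemma tri_le_half: "tri u \<le> 1/2"
  unfolding tri_def by linarith

lemma tri_periodic: "0 \<le> u \<Longrightarrow> u \<le> 1 \<Longrightarrow> tri (u - 1) = tri u"
  unfolding tri_def by linarith

text \<open>Translation invariance on the circle, in two pieces: [0, z) moves to [1 - z, 1) and
  [z, 1] moves to [0, 1 - z].\<close>

lemma nn_integral_tri_shift:
  fixes F :: "real \<Rightarrow> ennreal"
  assumes [measurable]: "F \<in> borel_measurable borel" and z: "0 \<le> z" "z \<le> 1"
  shows "(\<integral>\<^sup>+u. F (tri (u - z)) \<partial>unit_measure) = (\<integral>\<^sup>+u. F (tri u) \<partial>unit_measure)"
proof -
  have "(\<integral>\<^sup>+u. F (tri (u - z)) * indicator {0..1} u \<partial>lborel)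
      = (\<integral>\<^sup>+u. F (tri (u - z)) * indicator {0..<z} u + F (tri (u - z)) * indicator {z..1} u \<partial>lborel)"
    using z by (intro nn_integral_cong) (auto split: split_indicator)
  also have "\<dots> = (\<integral>\<^sup>+u. F (tri (u - z)) * indicator {0..<z} u \<partial>lborel)
      + (\<integral>\<^sup>+u. F (tri (u - z)) * indicator {z..1} u \<partial>lborel)"
    by (rule nn_integral_add) auto
  also have "(\<integral>\<^sup>+u. F (tri (u - z)) * indicator {0..<z} u \<partial>lborel)
      = (\<integral>\<^sup>+u. F (tri u) * indicator {1-z..<1} u \<partial>lborel)"
    by (subst nn_integral_real_affine[where c=1 and t="z-1"])
       (use z tri_periodic in \<open>auto intro!: nn_integral_cong split: split_indicator\<close>)
  also have "(\<integral>\<^sup>+u. F (tri (u - z)) * indicator {z..1} u \<partial>lborel)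
      = (\<integral>\<^sup>+u. F (tri u) * indicator {0..1-z} u \<partial>lborel)"
    by (subst nn_integral_real_affine[where c=1 and t="z"])
       (use z in \<open>auto intro!: nn_integral_cong split: split_indicator\<close>)
  also have "(\<integral>\<^sup>+u. F (tri u) * indicator {1-z..<1} u \<partial>lborel)
        + (\<integral>\<^sup>+u. F (tri u) * indicator {0..1-z} u \<partial>lborel)
      = (\<integral>\<^sup>+u. F (tri u) * indicator {1-z..<1} u + F (tri u) * indicator {0..1-z} u \<partial>lborel)"
    by (rule nn_integral_add[symmetric]) auto
  also have "\<dots> = (\<integral>\<^sup>+u. F (tri u) * indicator {0..1} u \<partial>lborel)"
  \<comment> \<open>The shifted pieces can overlap in the point 1 - z and miss the point 1, hence
    equality only almost everywhere.\<close>
  proof (rule nn_integral_cong_AE)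
    show "AE u in lborel. F (tri u) * indicator {1-z..<1} u + F (tri u) * indicator {0..1-z} u
        = F (tri u) * indicator {0..1} u"
      using AE_lborel_neq[of "1-z"] AE_lborel_neq[of 1]
      by eventually_elim (use z in \<open>auto split: split_indicator\<close>)
  qed
  finally show ?thesis by (simp add: nn_integral_unit_measure)
qed

text \<open>On [0, 1] the map \<open>tri\<close> is a two-to-one fold onto [0, 1/2]. After folding,
  the argument is linear in \<open>u\<close>, which is what dilations and exponential moments
  need.\<close>

lemma nn_integral_tri_fold:
  fixes F :: "real \<Rightarrow> ennreal"
  assumes [measurable]: "F \<in> borel_measurable borel"
  shows "(\<integral>\<^sup>+u. F (tri u) \<partial>unit_measure) = 2 * (\<integral>\<^sup>+u. F u * indicator {0..1/2} u \<partial>lborel)"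
proof -
  have "(\<integral>\<^sup>+u. F (tri u) * indicator {0..1} u \<partial>lborel)
      = (\<integral>\<^sup>+u. F u * indicator {0..1/2} u + F (1 - u) * indicator {1/2<..1} u \<partial>lborel)"
    by (intro nn_integral_cong) (auto split: split_indicator simp: tri_def min_def)
  also have "\<dots> = (\<integral>\<^sup>+u. F u * indicator {0..1/2} u \<partial>lborel)
      + (\<integral>\<^sup>+u. F (1 - u) * indicator {1/2<..1} u \<partial>lborel)"
    by (rule nn_integral_add) auto
  also have "(\<integral>\<^sup>+u. F (1 - u) * indicator {1/2<..1} u \<partial>lborel)
      = (\<integral>\<^sup>+u. F u * indicator {0..<1/2} u \<partial>lborel)"
    by (subst nn_integral_real_affine[where c="-1" and t=1])
       (auto intro!: nn_integral_cong split: split_indicator)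
  also have "\<dots> = (\<integral>\<^sup>+u. F u * indicator {0..1/2} u \<partial>lborel)"
    by (rule nn_integral_cong_AE)
       (use AE_lborel_neq[of "1/2"] in \<open>eventually_elim, auto split: split_indicator\<close>)
  finally show ?thesis by (simp add: nn_integral_unit_measure mult_2)
qed

text \<open>The measure of \<open>{u. tri (u 0) + \<dots> + tri (u (n - 1)) \<le> \<theta>}\<close> in the unit cube; for \<open>\<bar>u\<bar> \<le> 1\<close>
  the value \<open>tri u\<close> is the distance from \<open>u\<close> to the nearest integer.\<close>

primrec ballvol :: "nat \<Rightarrow> real \<Rightarrow> ennreal" where
  "ballvol 0 \<theta> = (if 0 \<le> \<theta> then 1 else 0)"
| "ballvol (Suc n) \<theta> = (\<integral>\<^sup>+u. ballvol n (\<theta> - tri u) \<partial>unit_measure)"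

lemma ballvol_borel [measurable]: "ballvol n \<in> borel_measurable borel"
proof (induction n)
  case 0
  have "ballvol 0 = (\<lambda>\<theta>. if 0 \<le> \<theta> then 1 else 0)" by auto
  then show ?case by simp
next
  case (Suc n)
  note [measurable] = Suc.IH
  have "ballvol (Suc n) = (\<lambda>\<theta>. \<integral>\<^sup>+u. ballvol n (\<theta> - tri u) * indicator {0..1} u \<partial>lborel)"
    by (auto simp: nn_integral_unit_measure)
  then show ?case by simp
qed

lemma ballvol_mono: "\<theta> \<le> \<theta>' \<Longrightarrow> ballvol n \<theta> \<le> ballvol n \<theta>'"
proof (induction n arbitrary: \<theta> \<theta>')
  case (Suc n)
  then show ?case by (auto intro!: nn_integral_mono)
qed auto

lemma ballvol_eq_1: "real n / 2 \<le> \<theta> \<Longrightarrow> ballvol n \<theta> = 1"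
proof (induction n arbitrary: \<theta>)
  case (Suc n)
  have "ballvol n (\<theta> - tri u) = 1" for u
    using Suc.prems tri_le_half[of u] by (intro Suc.IH) (simp add: field_simps)
  then show ?case by (simp add: unit.emeasure_space_1[simplified])
qed auto

lemma ballvol_Suc_fold:
  "ballvol (Suc n) \<theta> = 2 * (\<integral>\<^sup>+u. ballvol n (\<theta> - u) * indicator {0..1/2} u \<partial>lborel)"
  using nn_integral_tri_fold[of "\<lambda>u. ballvol n (\<theta> - u)"] by simp

text \<open>Dilating each of the \<open>n\<close> integrals costs a factor \<open>l\<close>. The
  constraint \<open>l * u\<close> \<le> 1/2 is stronger than \<open>u\<close> \<le> 1/2, so the
  domain of integration causes no further loss.\<close>

lemma ballvol_scale:
  assumes l: "1 \<le> l"
  shows "ballvol n (l * \<theta>) \<le> ennreal (l ^ n) * ballvol n \<theta>"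
proof (induction n arbitrary: \<theta>)
  case 0
  then show ?case using l by (auto simp: zero_le_mult_iff)
next
  case (Suc n)
  have "(\<integral>\<^sup>+u. ballvol n (l * \<theta> - u) * indicator {0..1/2} u \<partial>lborel)
      = ennreal l * (\<integral>\<^sup>+u. ballvol n (l * (\<theta> - u)) * indicator {0..1/2} (l * u) \<partial>lborel)"
    by (subst nn_integral_real_affine[where c=l and t=0])
       (use l in \<open>auto simp: algebra_simps\<close>)
  also have "\<dots> \<le> ennreal l * (\<integral>\<^sup>+u. ennreal (l ^ n) * (ballvol n (\<theta> - u) * indicator {0..1/2} u) \<partial>lborel)"
  proof (intro mult_left_mono nn_integral_mono)
    fix u
    have "u \<le> l * u" if "0 \<le> l * u"
      using l that by (simp add: zero_le_mult_iff mult_le_cancel_right1)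
    then have "indicator {0..1/2} (l * u) \<le> (indicator {0..1/2} u :: ennreal)"
      using l by (auto split: split_indicator simp: zero_le_mult_iff)
    then show "ballvol n (l * (\<theta> - u)) * indicator {0..1/2} (l * u)
       \<le> ennreal (l ^ n) * (ballvol n (\<theta> - u) * indicator {0..1/2} u)"
      unfolding mult.assoc[symmetric] by (intro mult_mono Suc.IH) auto
  qed auto
  also have "\<dots> = ennreal (l ^ Suc n) * (\<integral>\<^sup>+u. ballvol n (\<theta> - u) * indicator {0..1/2} u \<partial>lborel)"
    using l by (subst nn_integral_cmult) (auto simp: mult.assoc ennreal_mult)
  finally show ?case
    unfolding ballvol_Suc_fold mult.left_commute[of _ 2] by (rule mult_left_mono) simp
qed

text \<open>Exponential Markov inequality: the indicator of a sum being at most \<theta> is bounded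
  by exp (t (\<theta> - sum)), and each folded coordinate contributes at most twice the integral of
  exp (- t u) over the half-line, that is 2 / t.\<close>

lemma ballvol_chernoff:
  assumes t: "0 < t"
  shows "ballvol n \<theta> \<le> ennreal (exp (t * \<theta>) * (2 / t) ^ n)"
proof (induction n arbitrary: \<theta>)
  case 0
  then show ?case using t by auto
next
  case (Suc n)
  define C where "C = exp (t * \<theta>) * (2 / t) ^ n"
  have C: "0 \<le> C" using t by (simp add: C_def)
  have I: "(\<integral>\<^sup>+u. ennreal (C * exp (- t * u)) * indicator {0..} u \<partial>lborel) = ennreal (0 - (- C / t * exp (- t * 0)))"
  proof (rule nn_integral_FTC_atLeast)
    show "((\<lambda>u. - C / t * exp (- t * u)) has_real_derivative C * exp (- t * x)) (at x)" for x
      using t by (auto intro!: derivative_eq_intros)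
    have "((\<lambda>u. exp (- t * u)) \<longlongrightarrow> 0) at_top"
      using t by real_asymp
    from tendsto_mult_left[OF this, of "-C/t"] show "((\<lambda>u. - C / t * exp (- t * u)) \<longlongrightarrow> 0) at_top"
      by simp
  qed (use C in auto)
  have "(\<integral>\<^sup>+u. ballvol n (\<theta> - u) * indicator {0..1/2} u \<partial>lborel)
      \<le> (\<integral>\<^sup>+u. ennreal (C * exp (- t * u)) * indicator {0..} u \<partial>lborel)"
  proof (rule nn_integral_mono)
    fix u
    have "exp (t * (\<theta> - u)) * (2 / t) ^ n = C * exp (- t * u)"
      by (simp add: C_def exp_diff exp_minus algebra_simps divide_simps)
    then have "ballvol n (\<theta> - u) \<le> ennreal (C * exp (- t * u))"
      using Suc.IH[of "\<theta> - u"] by simp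
    then show "ballvol n (\<theta> - u) * indicator {0..1/2} u \<le> ennreal (C * exp (- t * u)) * indicator {0..} u"
      by (auto split: split_indicator)
  qed
  also have "\<dots> = ennreal (C / t)" unfolding I by simp
  finally have "ballvol (Suc n) \<theta> \<le> 2 * ennreal (C / t)"
    unfolding ballvol_Suc_fold by (intro mult_left_mono) auto
  also have "\<dots> = ennreal (2 * (C / t))"
    using C t ennreal_mult[of 2 "C / t"] by simp
  also have "2 * (C / t) = exp (t * \<theta>) * (2 / t) ^ Suc n"
    by (simp add: C_def)
  finally show ?case .
qed

section \<open>Integrals over the cube and grid points in a ball\<close>

lemma coordinate_borel [measurable (raw)]:
  "i \<in> I \<Longrightarrow> (\<lambda>x. x i) \<in> borel_measurable (\<Pi>\<^sub>M j\<in>I. unit_measure)"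
  by (rule measurable_compose[OF measurable_component_singleton])
     (auto intro!: measurable_restrict_space1)

text \<open>Fubini isolates one coordinate at a time, and \<open>nn_integral_tri_shift\<close>
  removes its centre; the volume therefore does not depend on \<open>z\<close>.\<close>

lemma nn_integral_ball_indicator:
  fixes J :: "nat set"
  assumes "finite J" and z: "\<And>j. j \<in> J \<Longrightarrow> 0 \<le> z j \<and> z j \<le> 1"
  shows "(\<integral>\<^sup>+x. indicator {..\<theta>} (\<Sum>j\<in>J. tri (x j - z j)) \<partial>(\<Pi>\<^sub>M j\<in>J. unit_measure))
       = ballvol (card J) \<theta>"
  using assms
proof (induction J arbitrary: \<theta> rule: finite_induct)
  case empty
  then show ?case by (simp add: PiM_empty)
next
  case (insert i J)
  have upd: "(\<Sum>j\<in>J. tri ((x(i := y)) j - z j)) = (\<Sum>j\<in>J. tri (x j - z j))" for x y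
    using insert.hyps by (intro sum.cong) auto
  have ind: "indicator {..\<theta>} (\<Sum>j\<in>insert i J. tri ((x(i := y)) j - z j))
      = (indicator {..\<theta> - tri (y - z i)} (\<Sum>j\<in>J. tri (x j - z j)) :: ennreal)" for x y
    using insert.hyps by (simp add: upd split: split_indicator del: fun_upd_apply) auto
  have "(\<integral>\<^sup>+x. indicator {..\<theta>} (\<Sum>j\<in>insert i J. tri (x j - z j)) \<partial>(\<Pi>\<^sub>M j\<in>insert i J. unit_measure))
      = (\<integral>\<^sup>+y. (\<integral>\<^sup>+x. indicator {..\<theta> - tri (y - z i)} (\<Sum>j\<in>J. tri (x j - z j))
          \<partial>(\<Pi>\<^sub>M j\<in>J. unit_measure)) \<partial>unit_measure)"
    by (subst unit_prod.product_nn_integral_insert_rev[OF insert.hyps(1,2)]) (measurable, simp only: ind)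
  also have "\<dots> = (\<integral>\<^sup>+y. ballvol (card J) (\<theta> - tri (y - z i)) \<partial>unit_measure)"
    using insert by simp
  also have "\<dots> = (\<integral>\<^sup>+y. ballvol (card J) (\<theta> - tri y) \<partial>unit_measure)"
    by (rule nn_integral_tri_shift) (use insert.prems in auto)
  finally show ?case using insert.hyps by simp
qed

text \<open>The outer half of axis \<open>i\<close> collects the points that the reflection of x_i
  moves across every secret interval, as these lie in [1/4, 3/4]. Measurability is assumed twice
  because \<open>G\<close> is integrated over both products.\<close>

lemma nn_integral_slab:
  fixes G :: "(nat \<Rightarrow> real) \<Rightarrow> ennreal"
  assumes J: "finite J" "i \<notin> J"
    and meas [measurable]: "G \<in> borel_measurable (\<Pi>\<^sub>M j\<in>insert i J. unit_measure)"
      "G \<in> borel_measurable (\<Pi>\<^sub>M j\<in>J. unit_measure)"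
    and indep: "\<And>x y. G (x(i := y)) = G x"
  shows "(\<integral>\<^sup>+x. G x * indicator ({..1/4} \<union> {3/4..}) (x i) \<partial>(\<Pi>\<^sub>M j\<in>insert i J. unit_measure))
       = (\<integral>\<^sup>+x. G x \<partial>(\<Pi>\<^sub>M j\<in>J. unit_measure)) / 2"
proof -
  have *: "(\<integral>\<^sup>+y. indicator ({..1/4} \<union> {3/4..}) y \<partial>unit_measure) = (1/2 :: ennreal)"
  proof -
    have "(\<integral>\<^sup>+y. indicator ({..1/4} \<union> {3/4..}) y \<partial>unit_measure)
       = (\<integral>\<^sup>+y. indicator ({0..1/4} \<union> {3/4..1}) y \<partial>(lborel :: real measure))"
      unfolding nn_integral_unit_measure
      by (intro nn_integral_cong) (auto split: split_indicator)
    also have "\<dots> = emeasure lborel ({0..1/4} \<union> {3/4..1::real})" by simp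
    also have "\<dots> = emeasure lborel {0..1/4::real} + emeasure lborel {3/4..1::real}"
      by (intro plus_emeasure[symmetric]) auto
    also have "\<dots> = ennreal (1/2)" by (simp flip: ennreal_plus)
    also have "ennreal (1/2) = 1/2" using divide_ennreal[of 1 2] by simp
    finally show ?thesis .
  qed
  have "(\<integral>\<^sup>+x. G x * indicator ({..1/4} \<union> {3/4..}) (x i) \<partial>(\<Pi>\<^sub>M j\<in>insert i J. unit_measure))
     = (\<integral>\<^sup>+x. \<integral>\<^sup>+y. G x * indicator ({..1/4} \<union> {3/4..}) y \<partial>unit_measure \<partial>(\<Pi>\<^sub>M j\<in>J. unit_measure))"
    using J by (subst unit_prod.product_nn_integral_insert) (measurable, auto simp: indep)
  also have "\<dots> = (\<integral>\<^sup>+x. G x * (1/2) \<partial>(\<Pi>\<^sub>M j\<in>J. unit_measure))"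
    by (subst nn_integral_cmult) (simp_all add: *)
  also have "\<dots> = (\<integral>\<^sup>+x. G x \<partial>(\<Pi>\<^sub>M j\<in>J. unit_measure)) * (1/2)"
    by (rule nn_integral_multc) simp
  finally show ?thesis by (simp add: divide_ennreal_def)
qed

text \<open>Moving the centre k / N to any point of its cell changes \<open>tri\<close> by at most 1
  / N, which the larger radius absorbs. The cells are disjoint, so the sum is dominated by an
  integral.\<close>

lemma ballvol_riemann_sum_le:
  assumes N: "0 < N" and x: "0 \<le> x" "x \<le> 1"
  shows "(\<Sum>k<N. ballvol n (\<theta> - tri (x - real k / real N)))
       \<le> of_nat N * ballvol (Suc n) (\<theta> + 1 / real N)"
proof -
  define c where "c k = ballvol n (\<theta> - tri (x - real k / real N))" for k
  define I where "I k = {real k / real N..<(real k + 1) / real N}" for k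
  have I: "emeasure lborel (I k) = ennreal (1 / real N)" for k
    using N by (simp add: I_def divide_right_mono diff_divide_distrib[symmetric])
  have pt: "(\<Sum>k<N. c k * indicator (I k) u)
      \<le> ballvol n (\<theta> + 1 / real N - tri (u - x)) * indicator {0..1} u" for u
  proof (cases "\<exists>k<N. u \<in> I k")
    case True
    then obtain k where k: "k < N" "u \<in> I k" by blast
    have uniq: "j = k" if "u \<in> I j" for j
    proof -
      have "real j \<le> u * N" "u * N < real j + 1" "real k \<le> u * N" "u * N < real k + 1"
        using that k N by (auto simp: I_def field_simps)
      then show ?thesis by linarith
    qed
    have "(\<Sum>k<N. c k * indicator (I k) u) = (\<Sum>j<N. if j = k then c k else 0)"
    proof (intro sum.cong refl)
      show "c j * indicator (I j) u = (if j = k then c k else 0)" for j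
        using uniq[of j] k(2) by (cases "u \<in> I j") auto
    qed
    also have "\<dots> = c k" using k by simp
    also have "\<dots> \<le> ballvol n (\<theta> + 1 / real N - tri (u - x))"
      unfolding c_def
    proof (rule ballvol_mono)
      have "tri (u - x) = tri (x - u)" by (simp add: tri_def abs_minus_commute)
      moreover have "\<bar>tri (x - u) - tri (x - real k / real N)\<bar> \<le> \<bar>(x - u) - (x - real k / real N)\<bar>"
        by (rule tri_lipschitz)
      moreover have "\<bar>(x - u) - (x - real k / real N)\<bar> \<le> 1 / real N"
        using k by (auto simp: I_def add_divide_distrib)
      ultimately show "\<theta> - tri (x - real k / real N) \<le> \<theta> + 1 / real N - tri (u - x)"
        by linarith
    qed
    also have "indicator {0..1} u = (1::ennreal)"
    proof -
      have "u < (real k + 1) / real N" "real k / real N \<le> u" using k by (auto simp: I_def)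
      moreover have "(real k + 1) / real N \<le> 1" using k N by (simp add: field_simps)
      moreover have "0 \<le> real k / real N" by simp
      ultimately have "0 \<le> u" "u \<le> 1" by linarith+
      then show ?thesis by simp
    qed
    ultimately show ?thesis by simp
  next
    case False
    then have "(\<Sum>k<N. c k * indicator (I k) u) = 0"
      by (intro sum.neutral) (auto split: split_indicator)
    then show ?thesis by simp
  qed
  have "(\<Sum>k<N. c k) * ennreal (1 / real N) = (\<Sum>k<N. c k * emeasure lborel (I k))"
    by (simp add: I sum_distrib_right)
  also have "\<dots> = (\<Sum>k<N. \<integral>\<^sup>+u. c k * indicator (I k) u \<partial>lborel)"
    by (intro sum.cong refl nn_integral_cmult_indicator[symmetric]) (simp add: I_def)
  also have "\<dots> = (\<integral>\<^sup>+u. (\<Sum>k<N. c k * indicator (I k) u) \<partial>lborel)"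
    by (subst nn_integral_sum) (auto simp: I_def)
  also have "\<dots> \<le> (\<integral>\<^sup>+u. ballvol n (\<theta> + 1 / real N - tri (u - x)) * indicator {0..1} u \<partial>lborel)"
    by (intro nn_integral_mono pt)
  also have "\<dots> = ballvol (Suc n) (\<theta> + 1 / real N)"
    using nn_integral_tri_shift[of "\<lambda>u. ballvol n (\<theta> + 1 / real N - u)" x] x
    by (simp add: nn_integral_unit_measure)
  finally have "(\<Sum>k<N. c k) * ennreal (1 / real N) \<le> ballvol (Suc n) (\<theta> + 1 / real N)" .
  then have "of_nat N * ((\<Sum>k<N. c k) * ennreal (1 / real N)) \<le> of_nat N * ballvol (Suc n) (\<theta> + 1 / real N)"
    by (rule mult_left_mono) simp
  also have "of_nat N * ((\<Sum>k<N. c k) * ennreal (1 / real N)) = (\<Sum>k<N. c k) * (ennreal (real N) * ennreal (1 / real N))"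
    by (simp add: ennreal_of_nat_eq_real_of_nat mult_ac)
  also have "ennreal (real N) * ennreal (1 / real N) = 1"
    using N by (simp flip: ennreal_mult)
  finally show ?thesis by (simp add: c_def)
qed

text \<open>The previous bound is applied once per coordinate, and each application adds 1 / N to
  the radius.\<close>

lemma card_grid_ball_le:
  assumes "finite J" and N: "0 < N" and "\<And>j. j \<in> J \<Longrightarrow> 0 \<le> x j \<and> x j \<le> 1"
  shows "of_nat (card {z \<in> J \<rightarrow>\<^sub>E {..<N}. (\<Sum>j\<in>J. tri (x j - real (z j) / real N)) \<le> \<theta>})
       \<le> of_nat (N ^ card J) * ballvol (card J) (\<theta> + real (card J) / real N)"
  using assms(1,3)
proof (induction J arbitrary: \<theta> rule: finite_induct)
  case empty
  then show ?case by (simp add: card_gt_0_iff)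
next
  case (insert i J)
  define S where "S \<theta> = {z \<in> J \<rightarrow>\<^sub>E {..<N}. (\<Sum>j\<in>J. tri (x j - real (z j) / real N)) \<le> \<theta>}" for \<theta>
  define n where "n = card J"
  have fin: "finite (S \<theta>)" for \<theta>
    unfolding S_def by (rule finite_subset[of _ "J \<rightarrow>\<^sub>E {..<N}"]) (auto intro: finite_PiE insert.hyps)
  have sub: "{z \<in> insert i J \<rightarrow>\<^sub>E {..<N}. (\<Sum>j\<in>insert i J. tri (x j - real (z j) / real N)) \<le> \<theta>}
     \<subseteq> (\<Union>k<N. (\<lambda>g. g(i := k)) ` S (\<theta> - tri (x i - real k / real N)))" (is "?L \<subseteq> ?R")
  proof
    fix z assume "z \<in> ?L"
    then have z: "z \<in> insert i J \<rightarrow>\<^sub>E {..<N}" "(\<Sum>j\<in>insert i J. tri (x j - real (z j) / real N)) \<le> \<theta>"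
      by auto
    define g where "g = z(i := undefined)"
    have "g \<in> J \<rightarrow>\<^sub>E {..<N}" using z insert.hyps by (auto simp: g_def PiE_iff extensional_def)
    moreover have "(\<Sum>j\<in>J. tri (x j - real (g j) / real N)) = (\<Sum>j\<in>J. tri (x j - real (z j) / real N))"
      using insert.hyps by (intro sum.cong) (auto simp: g_def)
    ultimately have "g \<in> S (\<theta> - tri (x i - real (z i) / real N))"
      using z(2) insert.hyps by (simp add: S_def)
    moreover have "z = g(i := z i)" by (simp add: g_def)
    moreover have "z i < N" using z by auto
    ultimately show "z \<in> ?R" by blast
  qed
  have "card ?L \<le> card ?R" by (intro card_mono sub) (auto intro: fin)
  also have "\<dots> \<le> (\<Sum>k<N. card ((\<lambda>g. g(i := k)) ` S (\<theta> - tri (x i - real k / real N))))"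
    by (rule card_UN_le) simp
  also have "\<dots> \<le> (\<Sum>k<N. card (S (\<theta> - tri (x i - real k / real N))))"
    by (intro sum_mono card_image_le fin)
  finally have "of_nat (card ?L) \<le> (of_nat (\<Sum>k<N. card (S (\<theta> - tri (x i - real k / real N)))) :: ennreal)"
    by (rule of_nat_mono)
  also have "\<dots> = (\<Sum>k<N. of_nat (card (S (\<theta> - tri (x i - real k / real N)))))" by simp
  also have "\<dots> \<le> (\<Sum>k<N. of_nat (N ^ n) * ballvol n ((\<theta> + real n / real N) - tri (x i - real k / real N)))"
  proof (rule sum_mono)
    fix k
    show "of_nat (card (S (\<theta> - tri (x i - real k / real N))))
      \<le> of_nat (N ^ n) * ballvol n ((\<theta> + real n / real N) - tri (x i - real k / real N))"
      using insert.IH[of "\<theta> - tri (x i - real k / real N)"] insert.prems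
      by (simp add: S_def n_def algebra_simps)
  qed
  also have "\<dots> = of_nat (N ^ n) * (\<Sum>k<N. ballvol n ((\<theta> + real n / real N) - tri (x i - real k / real N)))"
    by (simp add: sum_distrib_left)
  also have "\<dots> \<le> of_nat (N ^ n) * (of_nat N * ballvol (Suc n) ((\<theta> + real n / real N) + 1 / real N))"
    by (intro mult_left_mono ballvol_riemann_sum_le N) (use insert.prems in auto)
  also have "\<dots> = of_nat (N ^ Suc n) * ballvol (Suc n) (\<theta> + real (Suc n) / real N)"
    by (simp add: mult_ac add_divide_distrib add.assoc del: ballvol.simps) (simp add: add.commute)
  finally show ?case using insert.hyps by (simp add: n_def del: ballvol.simps)
qed

section \<open>The hard functions\<close>

definition ramp :: "real \<Rightarrow> real \<Rightarrow> real \<Rightarrow> real" where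
  "ramp \<zeta> w s = max 0 (min 1 ((\<zeta> + w - s) / w))"

definition hard :: "nat \<Rightarrow> real \<Rightarrow> nat \<Rightarrow> real \<Rightarrow> real \<Rightarrow> ((nat \<Rightarrow> real) \<Rightarrow> real) \<Rightarrow> (nat \<Rightarrow> real) \<Rightarrow> real" where
  "hard d a i \<zeta> w \<phi> x = a * (\<Sum>j\<in>{..<d} - {i}. x j) + \<phi> x * ramp \<zeta> w (x i)"

lemma ramp_borel [measurable]: "ramp \<zeta> w \<in> borel_measurable borel"
  unfolding ramp_def[abs_def] by measurable

lemma ramp_bounds: "0 \<le> ramp \<zeta> w s" "ramp \<zeta> w s \<le> 1"
  by (auto simp: ramp_def)

lemma abs_mult_ramp_le: "\<bar>c * ramp \<zeta> w s\<bar> \<le> \<bar>c\<bar>"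
  by (simp add: abs_mult ramp_bounds mult_left_le)

lemma ramp_eq_1: "0 < w \<Longrightarrow> s \<le> \<zeta> \<Longrightarrow> ramp \<zeta> w s = 1"
  by (auto simp: ramp_def min_def max_def field_simps)

lemma ramp_eq_0: "0 < w \<Longrightarrow> \<zeta> + w \<le> s \<Longrightarrow> ramp \<zeta> w s = 0"
  by (auto simp: ramp_def min_def max_def field_simps)

lemma ramp_lipschitz:
  assumes "0 < w" shows "\<bar>ramp \<zeta> w s - ramp \<zeta> w t\<bar> \<le> \<bar>s - t\<bar> / w"
proof -
  have "\<bar>ramp \<zeta> w s - ramp \<zeta> w t\<bar> \<le> \<bar>(\<zeta> + w - s) / w - (\<zeta> + w - t) / w\<bar>"
    unfolding ramp_def by linarith
  also have "(\<zeta> + w - s) / w - (\<zeta> + w - t) / w = - ((s - t) / w)"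
    by (simp add: diff_divide_distrib add_divide_distrib)
  finally show ?thesis using assms by (simp add: abs_divide)
qed

lemma ramp_antimono:
  assumes "0 < w" "s \<le> t" shows "ramp \<zeta> w t \<le> ramp \<zeta> w s"
proof -
  have "(\<zeta> + w - t) / w \<le> (\<zeta> + w - s) / w" using assms by (intro divide_right_mono) auto
  then show ?thesis unfolding ramp_def by linarith
qed

text \<open>The height M w / 2 limits the slope of the fall along x_i to M / 2. The second bound is
  half of the slope M / (4 sqrt d) used in \<open>hard\<close>, so half of the growth in the other
  coordinates survives. Its sum omits \<open>i\<close>, which makes \<phi> independent of
  x_i.\<close>

definition amplitude :: "nat \<Rightarrow> real \<Rightarrow> nat \<Rightarrow> real \<Rightarrow> ((nat \<Rightarrow> real) \<Rightarrow> real) \<Rightarrow> bool" where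
  "amplitude d M i w \<phi> \<longleftrightarrow> (\<forall>x. 0 \<le> \<phi> x \<and> \<phi> x \<le> M * w / 2) \<and>
     (\<forall>x y. \<bar>\<phi> x - \<phi> y\<bar> \<le> M / (8 * sqrt (real d)) * (\<Sum>j\<in>{..<d} - {i}. \<bar>x j - y j\<bar>))"

lemma sum_abs_le_eucl_dist:
  "(\<Sum>j\<in>{..<d} - J. \<bar>x j - y j\<bar>) \<le> sqrt (real d) * eucl_dist d x y"
proof -
  have "(\<Sum>j\<in>{..<d} - J. \<bar>x j - y j\<bar>) \<le> (\<Sum>j<d. \<bar>x j - y j\<bar> * \<bar>1\<bar>)"
    by (simp) (rule sum_mono2, auto)
  also have "\<dots> \<le> L2_set (\<lambda>j. x j - y j) {..<d} * L2_set (\<lambda>_. 1) {..<d}"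
    by (rule L2_set_mult_ineq)
  also have "L2_set (\<lambda>_. 1) {..<d} = sqrt (real d)" by (simp add: L2_set_def)
  finally show ?thesis by (simp add: eucl_dist_def mult.commute)
qed

lemma abs_component_le_eucl_dist: "i < d \<Longrightarrow> \<bar>x i - y i\<bar> \<le> eucl_dist d x y"
  unfolding eucl_dist_def using member_le_L2_set[of "{..<d}" i "\<lambda>i. \<bar>x i - y i\<bar>"]
  by (simp add: L2_set_def)

text \<open>By Cauchy-Schwarz the linear term contributes at most M / 4 and the variation of \<phi>
  half of that; the ramp contributes M / 2. The total is 7/8 of M.\<close>

lemma lipschitz_hard:
  assumes d: "i < d" and M: "0 < M" and w: "0 < w" and amp: "amplitude d M i w \<phi>"
  shows "lipschitz_cube d M (hard d (M / (4 * sqrt (real d))) i \<zeta> w \<phi>)"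
  unfolding lipschitz_cube_def
proof (intro ballI)
  fix x y
  define a where "a = M / (4 * sqrt (real d))"
  define E where "E = eucl_dist d x y"
  define S where "S = (\<Sum>j\<in>{..<d} - {i}. \<bar>x j - y j\<bar>)"
  have sd: "0 < sqrt (real d)" using d by simp
  have E: "0 \<le> E" by (simp add: E_def eucl_dist_def L2_set_nonneg)
  have a: "0 < a" using M sd by (simp add: a_def)
  have S: "S \<le> sqrt (real d) * E" unfolding S_def E_def by (rule sum_abs_le_eucl_dist)
  have aS: "a * S \<le> M / 4 * E"
  proof -
    have "a * S \<le> a * (sqrt (real d) * E)" using S a by simp
    also have "\<dots> = M / 4 * E" using sd by (simp add: a_def)
    finally show ?thesis .
  qed
  have 1: "\<bar>a * (\<Sum>j\<in>{..<d} - {i}. x j) - a * (\<Sum>j\<in>{..<d} - {i}. y j)\<bar> \<le> a * S"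
    using a by (simp add: S_def abs_mult flip: right_diff_distrib sum_subtractf)
  have 2: "\<bar>\<phi> x - \<phi> y\<bar> \<le> a / 2 * S"
    using amp by (simp add: amplitude_def a_def S_def)
  have 3: "\<bar>(\<phi> x - \<phi> y) * ramp \<zeta> w (x i)\<bar> \<le> a / 2 * S"
    using 2 abs_mult_ramp_le[of "\<phi> x - \<phi> y" \<zeta> w "x i"] by linarith
  have 4: "\<bar>\<phi> y * (ramp \<zeta> w (x i) - ramp \<zeta> w (y i))\<bar> \<le> M / 2 * E"
  proof -
    have "\<bar>\<phi> y * (ramp \<zeta> w (x i) - ramp \<zeta> w (y i))\<bar> \<le> (M * w / 2) * (\<bar>x i - y i\<bar> / w)"
      unfolding abs_mult
      by (intro mult_mono ramp_lipschitz w) (use amp M w in \<open>auto simp: amplitude_def\<close>)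
    also have "\<dots> = M / 2 * \<bar>x i - y i\<bar>" using w by simp
    also have "\<dots> \<le> M / 2 * E"
      unfolding E_def using M by (intro mult_left_mono abs_component_le_eucl_dist d) auto
    finally show ?thesis .
  qed
  have "hard d a i \<zeta> w \<phi> x - hard d a i \<zeta> w \<phi> y
     = (a * (\<Sum>j\<in>{..<d} - {i}. x j) - a * (\<Sum>j\<in>{..<d} - {i}. y j))
       + (\<phi> x - \<phi> y) * ramp \<zeta> w (x i) + \<phi> y * (ramp \<zeta> w (x i) - ramp \<zeta> w (y i))"
    by (simp add: hard_def algebra_simps)
  then have "\<bar>hard d a i \<zeta> w \<phi> x - hard d a i \<zeta> w \<phi> y\<bar> \<le> a * S + a / 2 * S + M / 2 * E"
    using 1 3 4 by linarith
  also have "\<dots> = 3/2 * (a * S) + M * E / 2" by simp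
  also have "\<dots> \<le> M * E" using aS mult_nonneg_nonneg[of M E] E M by linarith
  finally show "\<bar>hard d (M / (4 * sqrt (real d))) i \<zeta> w \<phi> x - hard d (M / (4 * sqrt (real d))) i \<zeta> w \<phi> y\<bar>
      \<le> M * eucl_dist d x y"
    by (simp add: a_def E_def)
qed

section \<open>Pairs that reveal a hard function\<close>

text \<open>With a = M / (4 sqrt d), the linear term gains a H and the variation of \<phi> takes
  back at most half, so a violation needs a H / 2 < \<phi>(x) \<Delta>, where \<Delta> is the fall
  of the ramp. Since \<phi>(x) \<le> M w / 2, the bounds \<Delta> \<le> 1 and \<Delta> \<le> (y_i -
  x_i) / w give the two inequalities on \<open>H\<close>, while \<Delta> > 0 locates
  \<zeta>.\<close>

lemma hard_violation:
  fixes x y :: "nat \<Rightarrow> real"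
  assumes d: "i < d" and M: "0 < M" and w: "0 < w" and amp: "amplitude d M i w \<phi>"
    and le: "coord_le d x y"
    and rej: "hard d (M / (4 * sqrt (real d))) i \<zeta> w \<phi> y < hard d (M / (4 * sqrt (real d))) i \<zeta> w \<phi> x"
  defines "H \<equiv> \<Sum>j\<in>{..<d} - {i}. y j - x j"
  shows "0 < \<phi> x" "x i - w < \<zeta>" "\<zeta> < y i" "H < 4 * sqrt (real d) * w" "H < 4 * sqrt (real d) * (y i - x i)"
proof -
  define a where "a = M / (4 * sqrt (real d))"
  define \<Delta> where "\<Delta> = ramp \<zeta> w (x i) - ramp \<zeta> w (y i)"
  have sd: "0 < sqrt (real d)" using d by simp
  have a: "0 < a" using M sd by (simp add: a_def)
  have h: "x j \<le> y j" if "j < d" for j using le that by (auto simp: coord_le_def)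
  have H: "0 \<le> H" unfolding H_def using h by (intro sum_nonneg) auto
  have \<Delta>: "0 \<le> \<Delta>" "\<Delta> \<le> 1" "\<Delta> \<le> (y i - x i) / w"
    using ramp_antimono[OF w h[OF d], of \<zeta>] ramp_bounds[of \<zeta> w "x i"] ramp_bounds[of \<zeta> w "y i"]
      ramp_lipschitz[OF w, of \<zeta> "x i" "y i"] h[OF d]
    by (auto simp: \<Delta>_def)
  have \<phi>: "0 \<le> \<phi> x" "\<phi> x \<le> M * w / 2" using amp by (auto simp: amplitude_def)
  have "\<bar>\<phi> y - \<phi> x\<bar> \<le> a / 2 * (\<Sum>j\<in>{..<d} - {i}. \<bar>y j - x j\<bar>)"
    using amp by (simp add: amplitude_def a_def)
  also have "(\<Sum>j\<in>{..<d} - {i}. \<bar>y j - x j\<bar>) = H"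
    unfolding H_def using h by (intro sum.cong) auto
  finally have 2: "\<bar>\<phi> y - \<phi> x\<bar> \<le> a / 2 * H" .
  have 3: "- (a / 2 * H) \<le> (\<phi> y - \<phi> x) * ramp \<zeta> w (y i)"
    using 2 abs_mult_ramp_le[of "\<phi> y - \<phi> x" \<zeta> w "y i"] by linarith
  \<comment> \<open>The product is split so that \<Delta> is multiplied by \<phi> at
    \<open>x\<close>: a violation then shows that the bump is active at the lower endpoint, whatever
    the other endpoint is.\<close>
  have "hard d a i \<zeta> w \<phi> y - hard d a i \<zeta> w \<phi> x
     = a * H + (\<phi> y - \<phi> x) * ramp \<zeta> w (y i) - \<phi> x * \<Delta>"
    by (simp add: hard_def H_def \<Delta>_def sum_subtractf algebra_simps)
  then have key: "a / 2 * H < \<phi> x * \<Delta>"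
    using rej[folded a_def] 3 by (simp add: field_simps)
  have pos: "0 < \<phi> x * \<Delta>" using key mult_nonneg_nonneg[of "a/2" H] a H by linarith
  then show "0 < \<phi> x" using \<phi> by (cases "\<phi> x = 0") auto
  have "0 < \<Delta>" using pos \<Delta>(1) by (cases "\<Delta> = 0") auto
  show "x i - w < \<zeta>"
  proof (rule ccontr)
    assume "\<not> ?thesis"
    then have "ramp \<zeta> w (x i) = 0" by (intro ramp_eq_0 w) simp
    then show False using \<open>0 < \<Delta>\<close> ramp_bounds(1)[of \<zeta> w "y i"] unfolding \<Delta>_def by linarith
  qed
  show "\<zeta> < y i"
  proof (rule ccontr)
    assume "\<not> ?thesis"
    then have "ramp \<zeta> w (y i) = 1" by (intro ramp_eq_1 w) simp
    then show False using \<open>0 < \<Delta>\<close> ramp_bounds(2)[of \<zeta> w "x i"] unfolding \<Delta>_def by linarith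
  qed
  have "a / 2 * H < M * w / 2"
  proof -
    have "\<phi> x * \<Delta> \<le> (M * w / 2) * 1" by (intro mult_mono \<phi> \<Delta>) (use M w in auto)
    with key show ?thesis by linarith
  qed
  then show "H < 4 * sqrt (real d) * w"
    using M sd by (simp add: a_def field_simps)
  have "a / 2 * H < (M * w / 2) * ((y i - x i) / w)"
  proof -
    have "\<phi> x * \<Delta> \<le> (M * w / 2) * ((y i - x i) / w)" by (intro mult_mono \<phi> \<Delta>) (use M w in auto)
    with key show ?thesis by linarith
  qed
  also have "\<dots> = M / 2 * (y i - x i)" using w by simp
  finally have less: "a / 2 * H < M / 2 * (y i - x i)" .
  show "H < 4 * sqrt (real d) * (y i - x i)"
  proof -
    have "a / 2 * H = M / 2 * (H / (4 * sqrt (real d)))" by (simp add: a_def)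
    with less have "M / 2 * (H / (4 * sqrt (real d))) < M / 2 * (y i - x i)" by linarith
    then have "H / (4 * sqrt (real d)) < y i - x i"
      by (rule mult_left_less_imp_less) (use M in simp)
    then show ?thesis using sd by (simp add: divide_less_eq mult.commute)
  qed
qed

lemma card_progression_le:
  fixes s t w :: real
  assumes w: "0 < w" and "s \<le> t"
  shows "real (card {k. k < L \<and> s < b + real k * w \<and> b + real k * w < t}) \<le> (t - s) / w + 1"
proof (cases "{k. k < L \<and> s < b + real k * w \<and> b + real k * w < t} = {}")
  case True
  then show ?thesis using assms by (simp del: Collect_empty_eq)
next
  case False
  define S where "S = {k. k < L \<and> s < b + real k * w \<and> b + real k * w < t}"
  have fin: "finite S" and ne: "S \<noteq> {}" using False by (auto simp: S_def)
  have "S \<subseteq> {Min S..Max S}" using fin by auto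
  then have "card S \<le> card {Min S..Max S}" by (intro card_mono) auto
  moreover have "Min S \<le> Max S" using fin ne by simp
  ultimately have c: "real (card S) \<le> real (Max S) - real (Min S) + 1" by simp
  have "Min S \<in> S" "Max S \<in> S" using fin ne by auto
  then have "s < b + real (Min S) * w" "b + real (Max S) * w < t" by (auto simp: S_def)
  then have "(real (Max S) - real (Min S)) * w \<le> t - s" by (simp add: algebra_simps)
  then have "real (Max S) - real (Min S) \<le> (t - s) / w" using w by (simp add: field_simps)
  with c show ?thesis unfolding S_def by linarith
qed

text \<open>Let T be the total increment. A coordinate able to detect (the set \<open>G\<close>)
  carries at least T / (5 sqrt d), so there are at most 5 sqrt d of them. Summing h_i / w + 2
  positions over \<open>G\<close> gives T / w + 10 sqrt d, and T \<le> 1 + 4 sqrt d w with w \<ge>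
  \<rho> / sqrt d bounds T / w by (1 / \<rho> + 4) sqrt d.\<close>

lemma sum_card_violations_le:
  fixes x y :: "nat \<Rightarrow> real" and L :: nat
  assumes d: "1 \<le> d" and w: "\<rho> / sqrt (real d) \<le> w" and \<rho>: "0 < \<rho>"
    and x: "x \<in> cube d" and y: "y \<in> cube d" and le: "coord_le d x y"
  defines "H i \<equiv> \<Sum>j\<in>{..<d} - {i}. y j - x j"
  defines "K i \<equiv> {k. k < L \<and> x i - w < 1/4 + real k * w \<and> 1/4 + real k * w < y i \<and>
     H i < 4 * sqrt (real d) * w \<and> H i < 4 * sqrt (real d) * (y i - x i)}"
  shows "real (\<Sum>i<d. card (K i)) \<le> (1 / \<rho> + 14) * sqrt (real d)"
proof -
  define q where "q = sqrt (real d)"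
  define h where "h i = y i - x i" for i
  have q: "1 \<le> q" using d by (simp add: q_def)
  have w0: "0 < w" using w \<rho> q by (intro less_le_trans[OF _ w]) (simp add: q_def)
  have h: "0 \<le> h i" "h i \<le> 1" if "i < d" for i
    using le x y that by (auto simp: h_def coord_le_def cube_def PiE_iff dest!: bspec[of _ _ i])
  define G where "G = {i. i < d \<and> H i < 4 * q * w \<and> H i < 4 * q * h i}"
  define T where "T = (\<Sum>j<d. h j)"
  have HT: "H i = T - h i" if "i < d" for i
    using that by (simp add: H_def T_def h_def sum_diff1)
  have H0: "0 \<le> H i" for i unfolding H_def using h by (intro sum_nonneg) (auto simp: h_def)
  have finG: "finite G" "G \<subseteq> {..<d}" by (auto simp: G_def)
  have K: "real (card (K i)) \<le> (if i \<in> G then h i / w + 2 else 0)" if "i < d" for i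
  proof (cases "i \<in> G")
    case True
    have "card (K i) \<le> card {k. k < L \<and> x i - w < 1/4 + real k * w \<and> 1/4 + real k * w < y i}"
      by (rule card_mono) (auto simp: K_def)
    then have "real (card (K i)) \<le> (y i - (x i - w)) / w + 1"
      using card_progression_le[OF w0, of "x i - w" "y i" L "1/4"] h[OF that] w0
      by (simp add: h_def)
    \<comment> \<open>One unit accounts for ramps that start up to \<open>w\<close> below x_i, the
      other for rounding in the progression.\<close>
    also have "\<dots> = h i / w + 2" using w0 by (simp add: h_def field_simps)
    finally show ?thesis using True by simp
  next
    case False
    then have "K i = {}" using that by (auto simp: K_def G_def q_def h_def)
    then show ?thesis using False by simp
  qed
  have "real (\<Sum>i<d. card (K i)) \<le> (\<Sum>i<d. if i \<in> G then h i / w + 2 else 0)"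
    unfolding of_nat_sum by (rule sum_mono) (use K in auto)
  also have "\<dots> = (\<Sum>i\<in>G. h i / w + 2)"
    using finG by (simp add: sum.If_cases Int_absorb1)
  also have "\<dots> = (\<Sum>i\<in>G. h i) / w + 2 * real (card G)"
    by (simp add: sum.distrib sum_divide_distrib)
  finally have main: "real (\<Sum>i<d. card (K i)) \<le> (\<Sum>i\<in>G. h i) / w + 2 * real (card G)" .
  show ?thesis
  proof (cases "G = {}")
    case True
    then have "real (\<Sum>i<d. card (K i)) \<le> 0" using main by simp
    also have "\<dots> \<le> (1 / \<rho> + 14) * sqrt (real d)" using \<rho> by (intro mult_nonneg_nonneg) auto
    finally show ?thesis .
  next
    case False
    then obtain g where g: "g \<in> G" by blast
    then have gd: "g < d" by (simp add: G_def)
    have GT: "(\<Sum>i\<in>G. h i) \<le> T"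
      unfolding T_def using finG h by (intro sum_mono2) auto
    have T: "T \<le> 1 + 4 * q * w" using g HT[OF gd] h[OF gd] by (auto simp: G_def)
    \<comment> \<open>The strict inequality in \<open>G\<close> makes \<open>T\<close> positive, so
      that it can be cancelled in the bound on \<open>card G\<close>.\<close>
    have "0 < 4 * q * h g" using g H0[of g] by (auto simp: G_def)
    then have "0 < h g" using q by (simp add: zero_less_mult_iff)
    then have T0: "0 < T" using HT[OF gd] H0[of g] by linarith
    have "T \<le> 5 * q * h i" if "i \<in> G" for i
    proof -
      have "H i < 4 * q * h i" "i < d" using that by (auto simp: G_def)
      then have "T \<le> 4 * q * h i + 1 * h i" using HT[of i] by simp
      also have "1 * h i \<le> q * h i" using q h[OF \<open>i < d\<close>] by (intro mult_right_mono) auto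
      finally show ?thesis by simp
    qed
    then have "(\<Sum>i\<in>G. T) \<le> (\<Sum>i\<in>G. 5 * q * h i)" by (rule sum_mono)
    then have "real (card G) * T \<le> 5 * q * (\<Sum>i\<in>G. h i)" by (simp add: sum_distrib_left)
    also have "\<dots> \<le> 5 * q * T" using GT q by (intro mult_left_mono) auto
    finally have cG: "real (card G) \<le> 5 * q" using T0 by simp
    have "1 \<le> (1 / \<rho>) * q * w" using w \<rho> q by (simp add: field_simps q_def)
    then have "T \<le> ((1 / \<rho> + 4) * q) * w" using T by (simp add: algebra_simps)
    then have "T / w \<le> (1 / \<rho> + 4) * q" using w0 by (simp add: divide_le_eq)
    moreover have "(\<Sum>i\<in>G. h i) / w \<le> T / w" using GT w0 by (simp add: divide_right_mono)
    ultimately show ?thesis using main cG by (simp add: q_def algebra_simps)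
  qed
qed

section \<open>Distance to monotonicity by reflection\<close>

lemma space_unit_product: "space (\<Pi>\<^sub>M j\<in>{..<d}. unit_measure) = cube d"
  by (simp add: space_PiM cube_def)

lemma prob_space_unit_product: "prob_space (\<Pi>\<^sub>M j\<in>I. unit_measure)"
  by (intro prob_space_PiM prob_space_unit_measure)

text \<open>Fubini isolates coordinate \<open>i\<close>, where the claim is the substitution of 1 -
  y for y.\<close>

lemma nn_integral_reflect:
  fixes F :: "(nat \<Rightarrow> real) \<Rightarrow> ennreal"
  assumes i: "i < d" and F [measurable]: "F \<in> borel_measurable (\<Pi>\<^sub>M j\<in>{..<d}. unit_measure)"
  shows "(\<integral>\<^sup>+x. F (x(i := 1 - x i)) \<partial>(\<Pi>\<^sub>M j\<in>{..<d}. unit_measure)) = (\<integral>\<^sup>+x. F x \<partial>(\<Pi>\<^sub>M j\<in>{..<d}. unit_measure))"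
    and "(\<lambda>x. F (x(i := 1 - x i))) \<in> borel_measurable (\<Pi>\<^sub>M j\<in>{..<d}. unit_measure)"
proof -
  define J where "J = {..<d} - {i}"
  have J: "finite J" "i \<notin> J" "{..<d} = insert i J" using i by (auto simp: J_def)
  have [measurable]: "(\<lambda>x. x(i := 1 - x i)) \<in> (\<Pi>\<^sub>M j\<in>{..<d}. unit_measure) \<rightarrow>\<^sub>M (\<Pi>\<^sub>M j\<in>{..<d}. unit_measure)"
  proof (rule measurable_PiM_single')
    show "(\<lambda>x. (x(i := 1 - x i)) j) \<in> (\<Pi>\<^sub>M j\<in>{..<d}. unit_measure) \<rightarrow>\<^sub>M unit_measure" if "j \<in> {..<d}" for j
    proof (cases "j = i")
      case True
      have "(\<lambda>x. 1 - x i) \<in> (\<Pi>\<^sub>M j\<in>{..<d}. unit_measure) \<rightarrow>\<^sub>M unit_measure"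
        by (rule measurable_restrict_space2)
           (use i in \<open>auto simp: space_PiM PiE_iff\<close>)
      then show ?thesis using True by simp
    next
      case False
      then show ?thesis using that by simp
    qed
    show "(\<lambda>x. x(i := 1 - x i)) \<in> space (\<Pi>\<^sub>M j\<in>{..<d}. unit_measure) \<rightarrow> (\<Pi>\<^sub>E j\<in>{..<d}. space unit_measure)"
      using i by (auto simp: space_PiM PiE_iff extensional_def)
  qed
  show meas: "(\<lambda>x. F (x(i := 1 - x i))) \<in> borel_measurable (\<Pi>\<^sub>M j\<in>{..<d}. unit_measure)"
    by measurable
  have refl: "(\<integral>\<^sup>+y. E (1 - y) \<partial>unit_measure) = (\<integral>\<^sup>+y. E y \<partial>unit_measure)"
    if "E \<in> borel_measurable unit_measure" for E :: "real \<Rightarrow> ennreal"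
  proof -
    have [measurable]: "(\<lambda>y. E y * indicator {0..1} y) \<in> borel_measurable borel"
      using that by (subst (asm) borel_measurable_restrict_space_iff_ennreal) auto
    show ?thesis
      unfolding nn_integral_unit_measure
      by (subst (2) nn_integral_real_affine[where c="-1" and t=1])
         (auto intro!: nn_integral_cong split: split_indicator)
  qed
  have "(\<integral>\<^sup>+x. F (x(i := 1 - x i)) \<partial>(\<Pi>\<^sub>M j\<in>{..<d}. unit_measure))
      = (\<integral>\<^sup>+x. \<integral>\<^sup>+y. F (x(i := 1 - y)) \<partial>unit_measure \<partial>(\<Pi>\<^sub>M j\<in>J. unit_measure))"
    using unit_prod.product_nn_integral_insert[OF J(1,2), of "\<lambda>x. F (x(i := 1 - x i))"] meas
    by (simp add: J(3))
  also have "\<dots> = (\<integral>\<^sup>+x. \<integral>\<^sup>+y. F (x(i := y)) \<partial>unit_measure \<partial>(\<Pi>\<^sub>M j\<in>J. unit_measure))"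
  proof (rule nn_integral_cong)
    fix x assume x: "x \<in> space (\<Pi>\<^sub>M j\<in>J. unit_measure)"
    have "(\<lambda>y. F (x(i := y))) \<in> borel_measurable unit_measure"
      using measurable_comp[OF measurable_component_update[OF x J(2)], of F borel] F
      by (simp add: comp_def J(3))
    from refl[OF this] show "(\<integral>\<^sup>+y. F (x(i := 1 - y)) \<partial>unit_measure) = (\<integral>\<^sup>+y. F (x(i := y)) \<partial>unit_measure)" .
  qed
  also have "\<dots> = (\<integral>\<^sup>+x. F x \<partial>(\<Pi>\<^sub>M j\<in>{..<d}. unit_measure))"
    using unit_prod.product_nn_integral_insert[OF J(1,2), of F] F by (simp add: J(3))
  finally show "(\<integral>\<^sup>+x. F (x(i := 1 - x i)) \<partial>(\<Pi>\<^sub>M j\<in>{..<d}. unit_measure)) = \<dots>" .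
qed

text \<open>The point and its mirror image lie on opposite sides of the ramp, so the hard function
  drops by \<phi>(x) \<ge> A from \<open>x\<close> to \<open>x'\<close>, whereas \<open>g\<close>
  does not drop. The two errors must make up the difference.\<close>

lemma hard_dist_pointwise:
  assumes i: "i < d" and w: "0 < w" and \<zeta>: "1/4 \<le> \<zeta>" "\<zeta> + w \<le> 3/4"
    and \<phi>: "\<And>y. \<phi> (x(i := y)) = \<phi> x" "A \<le> \<phi> x"
    and g: "monotone_cube d g" and x: "x \<in> cube d" and xi: "x i \<le> 1/4"
  defines "x' \<equiv> x(i := 1 - x i)"
  shows "A \<le> \<bar>hard d a i \<zeta> w \<phi> x - g x\<bar> + \<bar>hard d a i \<zeta> w \<phi> x' - g x'\<bar>"
proof -
  have xi': "0 \<le> x i" "x i \<le> 1" using x i by (auto simp: cube_def PiE_iff)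
  have x': "x' \<in> cube d" using x i by (auto simp: x'_def cube_def PiE_iff extensional_def)
  have "coord_le d x x'" using xi by (auto simp: coord_le_def x'_def)
  then have "g x \<le> g x'" using g x x' by (auto simp: monotone_cube_def)
  moreover have "ramp \<zeta> w (x i) = 1" using xi \<zeta> by (intro ramp_eq_1 w) linarith
  moreover have "ramp \<zeta> w (x' i) = 0" using xi \<zeta> by (intro ramp_eq_0 w) (simp add: x'_def)
  moreover have "(\<Sum>j\<in>{..<d} - {i}. x' j) = (\<Sum>j\<in>{..<d} - {i}. x j)"
    by (intro sum.cong) (auto simp: x'_def)
  ultimately show ?thesis using \<phi>(2) by (simp add: hard_def)
qed

text \<open>The pointwise bound is integrated over the part of the outer half of axis
  \<open>i\<close> where \<phi> has full height, of volume at least \<open>v\<close>. The error and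
  its reflection have the same integral, so that integral is at least half of (M w / 2) v.\<close>

lemma dist_mono1_hard_ge:
  assumes i: "i < d" and M: "0 < M" and w: "0 < w" and \<zeta>: "1/4 \<le> \<zeta>" "\<zeta> + w \<le> 3/4"
    and amp: "amplitude d M i w \<phi>"
    and \<phi> [measurable]: "\<phi> \<in> borel_measurable (\<Pi>\<^sub>M j\<in>{..<d}. unit_measure)"
    and v: "0 \<le> v" "ennreal v \<le> (\<integral>\<^sup>+x. indicator {M * w / 2..} (\<phi> x) * indicator ({..1/4} \<union> {3/4..}) (x i)
        \<partial>(\<Pi>\<^sub>M j\<in>{..<d}. unit_measure))"
  shows "M * w * v / 4 \<le> dist_mono1 d (hard d a i \<zeta> w \<phi>)"
proof -
  define P where "P = (\<Pi>\<^sub>M j\<in>{..<d}. unit_measure)"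
  define A where "A = M * w / 2"
  define f where "f = hard d a i \<zeta> w \<phi>"
  interpret P: prob_space P unfolding P_def by (rule prob_space_unit_product)
  have A: "0 \<le> A" using M w by (simp add: A_def)
  have \<phi>P [measurable]: "\<phi> \<in> borel_measurable P" using \<phi> by (simp add: P_def)
  have proj [measurable]: "(\<lambda>x. x j) \<in> borel_measurable P" if "j < d" for j
    unfolding P_def using that by (intro coordinate_borel) auto
  \<comment> \<open>The two points agree off \<open>i\<close>, so the Lipschitz bound of
    \<open>amplitude\<close> is zero.\<close>
  have upd: "\<phi> (x(i := y)) = \<phi> x" for x y
  proof -
    have "\<bar>\<phi> (x(i := y)) - \<phi> x\<bar>
        \<le> M / (8 * sqrt (real d)) * (\<Sum>j\<in>{..<d} - {i}. \<bar>(x(i := y)) j - x j\<bar>)"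
      using amp unfolding amplitude_def by blast
    also have "(\<Sum>j\<in>{..<d} - {i}. \<bar>(x(i := y)) j - x j\<bar>) = 0" by (intro sum.neutral) auto
    finally show ?thesis by (simp del: fun_upd_apply)
  qed
  have fmeas: "f \<in> borel_measurable P"
  proof -
    have "(\<lambda>x. \<Sum>j\<in>{..<d} - {i}. x j) \<in> borel_measurable P"
      by (intro borel_measurable_sum proj) auto
    then show ?thesis using proj[OF i] unfolding f_def hard_def[abs_def] by measurable
  qed
  have fint: "integrable P f"
  proof (rule P.integrable_const_bound[OF _ fmeas])
    show "AE x in P. norm (f x) \<le> \<bar>a\<bar> * real d + A"
    proof (rule AE_I2)
      fix x assume "x \<in> space P"
      then have x: "\<And>j. j < d \<Longrightarrow> 0 \<le> x j \<and> x j \<le> 1"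
        by (auto simp: P_def space_unit_product cube_def PiE_iff)
      have "(\<Sum>j\<in>{..<d} - {i}. x j) \<le> (\<Sum>j\<in>{..<d} - {i}. 1)" using x by (intro sum_mono) auto
      also have "\<dots> \<le> real d" using card_mono[of "{..<d}" "{..<d} - {i}"] by simp
      finally have "(\<Sum>j\<in>{..<d} - {i}. x j) \<le> real d" .
      moreover have "0 \<le> (\<Sum>j\<in>{..<d} - {i}. x j)" using x by (intro sum_nonneg) auto
      ultimately have "\<bar>a * (\<Sum>j\<in>{..<d} - {i}. x j)\<bar> \<le> \<bar>a\<bar> * real d"
        by (simp add: abs_mult mult_left_mono)
      moreover have "\<bar>\<phi> x * ramp \<zeta> w (x i)\<bar> \<le> A"
      proof -
        have "\<bar>\<phi> x\<bar> \<le> A" using amp by (simp add: amplitude_def A_def)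
        with abs_mult_ramp_le[of "\<phi> x" \<zeta> w "x i"] show ?thesis by linarith
      qed
      ultimately show "norm (f x) \<le> \<bar>a\<bar> * real d + A"
        unfolding f_def hard_def real_norm_def by linarith
    qed
  qed
  have main: "A * v / 2 \<le> (\<integral>x. \<bar>f x - g x\<bar> \<partial>cube_measure d)"
    if g: "monotone_cube d g" "integrable (cube_measure d) g" for g
  proof -
    define h where "h x = ennreal \<bar>f x - g x\<bar>" for x
    have cm: "cube_measure d = completion P" by (simp add: cube_measure_def P_def)
    have "integrable (completion P) f" using fint fmeas by (simp add: integrable_completion)
    then have int: "integrable (completion P) (\<lambda>x. \<bar>f x - g x\<bar>)" using g(2) cm by simp
    have "(\<integral>\<^sup>+x. h x \<partial>completion P) = ennreal (\<integral>x. \<bar>f x - g x\<bar> \<partial>completion P)"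
      unfolding h_def by (rule nn_integral_eq_integral[OF int]) simp
    then have eq: "(\<integral>\<^sup>+x. h x \<partial>P) = ennreal (\<integral>x. \<bar>f x - g x\<bar> \<partial>completion P)"
      by (simp add: nn_integral_completion)
    \<comment> \<open>\<open>g\<close> is measurable only for the completion, while reflection is
      available for the product measure. The error \<open>h\<close> is therefore replaced by a
      product-measurable \<open>h'\<close>.\<close>
    have "h \<in> borel_measurable (completion P)"
      using borel_measurable_integrable[OF int] unfolding h_def[abs_def] by measurable
    from completion_ex_borel_measurable[OF this] obtain h'
      where h' [measurable]: "h' \<in> borel_measurable P" and ae: "AE x in P. h x = h' x" by blast
    from ae obtain N where N: "{x \<in> space P. h x \<noteq> h' x} \<subseteq> N" "N \<in> sets P" "emeasure P N = 0"
      by (auto elim: AE_E)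
    have mN: "indicator N \<in> borel_measurable P" using N(2) by simp
    note refl = nn_integral_reflect[OF i, folded P_def]
    \<comment> \<open>The null set outside which \<open>h\<close> and \<open>h'\<close> agree stays
      null under reflection; only then can \<open>h\<close> be replaced at the reflected point
      too.\<close>
    have "(\<integral>\<^sup>+x. indicator N (x(i := 1 - x i)) \<partial>P) = 0"
      using refl(1)[OF mN] N by simp
    then have "AE x in P. indicator N (x(i := 1 - x i)) = (0::ennreal)"
      by (subst (asm) nn_integral_0_iff_AE) (use refl(2)[OF mN] in auto)
    then have ae': "AE x in P. h (x(i := 1 - x i)) = h' (x(i := 1 - x i))"
    proof (rule AE_mp, intro AE_I2 impI)
      fix x assume x: "x \<in> space P" "indicator N (x(i := 1 - x i)) = (0::ennreal)"
      have "x(i := 1 - x i) \<in> space P"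
        using x(1) i by (auto simp: P_def space_unit_product cube_def PiE_iff extensional_def)
      moreover have "x(i := 1 - x i) \<notin> N" using x(2) by (simp add: indicator_def split: if_splits)
      ultimately show "h (x(i := 1 - x i)) = h' (x(i := 1 - x i))" using N(1) by blast
    qed
    have pt: "ennreal A * (indicator {M * w / 2..} (\<phi> x) * indicator ({..1/4} \<union> {3/4..}) (x i))
        \<le> h x + h (x(i := 1 - x i))" if x: "x \<in> space P" for x
    proof (cases "A \<le> \<phi> x \<and> (x i \<le> 1/4 \<or> 3/4 \<le> x i)")
      case True
      let ?x' = "x(i := 1 - x i)"
      have x: "x \<in> cube d" using x by (simp add: P_def space_unit_product)
      then have x': "?x' \<in> cube d" using i by (auto simp: cube_def PiE_iff extensional_def)
      have "A \<le> \<bar>f x - g x\<bar> + \<bar>f ?x' - g ?x'\<bar>"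
      proof (cases "x i \<le> 1/4")
        case le: True
        show ?thesis unfolding f_def
          by (rule hard_dist_pointwise[OF i w \<zeta> upd _ g(1) x le]) (use True in simp)
      next
        case False
        \<comment> \<open>A point of the upper quarter is the mirror image of one in the lower
          quarter, so the pointwise bound is applied to \<open>?x'\<close>.\<close>
        then have "?x' i \<le> 1/4" using True by simp
        moreover have "A \<le> \<phi> ?x'" using True by (simp add: upd del: fun_upd_apply)
        moreover have "?x'(i := 1 - ?x' i) = x" by simp
        ultimately have "A \<le> \<bar>f ?x' - g ?x'\<bar> + \<bar>f x - g x\<bar>"
          using hard_dist_pointwise[OF i w \<zeta> upd _ g(1) x', of A a] unfolding f_def by metis
        then show ?thesis by simp
      qed
      then have "ennreal A \<le> ennreal (\<bar>f x - g x\<bar> + \<bar>f ?x' - g ?x'\<bar>)" by (rule ennreal_leI)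
      also have "\<dots> = h x + h ?x'" by (simp add: h_def)
      finally show ?thesis by (auto split: split_indicator)
    next
      case False
      then show ?thesis by (auto simp: A_def split: split_indicator)
    qed
    have "ennreal (A * v) = ennreal A * ennreal v" using A v by (simp add: ennreal_mult)
    also have "\<dots> \<le> ennreal A * (\<integral>\<^sup>+x. indicator {M * w / 2..} (\<phi> x) * indicator ({..1/4} \<union> {3/4..}) (x i) \<partial>P)"
      using v by (intro mult_left_mono) (auto simp: P_def)
    also have "\<dots> = (\<integral>\<^sup>+x. ennreal A * (indicator {M * w / 2..} (\<phi> x) * indicator ({..1/4} \<union> {3/4..}) (x i)) \<partial>P)"
      by (intro nn_integral_cmult[symmetric] borel_measurable_times_ennreal
          measurable_compose[OF \<phi>P] measurable_compose[OF proj[OF i]]) simp_all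
    also have "\<dots> \<le> (\<integral>\<^sup>+x. h x + h (x(i := 1 - x i)) \<partial>P)"
      by (intro nn_integral_mono pt)
    also have "\<dots> = (\<integral>\<^sup>+x. h' x + h' (x(i := 1 - x i)) \<partial>P)"
      by (rule nn_integral_cong_AE) (use ae ae' in eventually_elim, simp)
    also have "\<dots> = (\<integral>\<^sup>+x. h' x \<partial>P) + (\<integral>\<^sup>+x. h' (x(i := 1 - x i)) \<partial>P)"
      by (rule nn_integral_add[OF h' refl(2)[OF h']])
    also have "(\<integral>\<^sup>+x. h' (x(i := 1 - x i)) \<partial>P) = (\<integral>\<^sup>+x. h' x \<partial>P)" by (rule refl(1)[OF h'])
    also have "(\<integral>\<^sup>+x. h' x \<partial>P) = (\<integral>\<^sup>+x. h x \<partial>P)"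
      by (rule nn_integral_cong_AE) (use ae in eventually_elim, simp)
    finally have "ennreal (A * v) \<le> ennreal (2 * (\<integral>x. \<bar>f x - g x\<bar> \<partial>completion P))"
      unfolding eq by (simp flip: ennreal_plus)
    then have "A * v \<le> 2 * (\<integral>x. \<bar>f x - g x\<bar> \<partial>completion P)"
      by (subst (asm) ennreal_le_iff) auto
    then show ?thesis by (simp add: cm)
  qed
  have "A * v / 2 \<le> dist_mono1 d f"
    unfolding dist_mono1_def
  proof (rule cInf_greatest)
    \<comment> \<open>A lower bound transfers to \<open>Inf\<close> only for a nonempty set; the
      zero function is a witness.\<close>
    have "monotone_cube d (\<lambda>_. 0) \<and> integrable (cube_measure d) (\<lambda>_. 0::real)"
      by (simp add: monotone_cube_def)
    then show "{(\<integral>x. \<bar>f x - g x\<bar> \<partial>cube_measure d) | g. monotone_cube d g \<and> integrable (cube_measure d) g} \<noteq> {}"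
      by blast
  qed (use main in blast)
  then show ?thesis by (simp add: A_def f_def)
qed

text \<open>Near \<open>x\<close> the pair with difference \<open>s * v\<close> is split between the two endpoints so that both stay
  in the cube; as \<open>F\<close> is finite, one small \<open>s\<close> serves all of \<open>F\<close>.\<close>

lemma deriv_violation_imp_pair_violation:
  assumes fin: "finite F" and x: "x \<in> cube d" and v: "\<And>i. i < d \<Longrightarrow> 0 \<le> v i"
    and rej: "\<And>f. f \<in> F \<Longrightarrow> \<exists>p. has_gradient d f x p \<and> (\<Sum>i<d. v i * p i) < 0"
  shows "\<exists>x'\<in>cube d. \<exists>y'\<in>cube d. coord_le d x' y' \<and> (\<forall>f\<in>F. f y' < f x')"
proof -
  define X where "X s = (\<lambda>i. if i < d then (if x i < 1 then x i else x i - s * v i) else undefined)" for s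
  define Y where "Y s = (\<lambda>i. if i < d then (if x i < 1 then x i + s * v i else x i) else undefined)" for s
  have xb: "0 \<le> x i" "x i \<le> 1" if "i < d" for i
    using x that by (auto simp: cube_def PiE_iff)
  have pos: "\<forall>\<^sub>F s in at_right 0. (0::real) < s" by (rule eventually_at_right_less)
  have in01: "\<forall>\<^sub>F s in at_right 0. \<forall>i\<in>{..<d}. X s i \<in> {0..1} \<and> Y s i \<in> {0..1}"
  proof (intro eventually_ball_finite ballI)
    fix i assume "i \<in> {..<d}"
    then have i: "i < d" by simp
    show "\<forall>\<^sub>F s in at_right 0. X s i \<in> {0..1} \<and> Y s i \<in> {0..1}"
    proof (cases "x i < 1")
      case True
      have "((\<lambda>s. x i + s * v i) \<longlongrightarrow> x i + 0 * v i) (at_right 0)" by (intro tendsto_intros)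
      then have "\<forall>\<^sub>F s in at_right 0. x i + s * v i < 1" using True by (intro order_tendstoD) auto
      with pos show ?thesis
        by eventually_elim (use True i xb[OF i] v[OF i] in \<open>auto simp: X_def Y_def\<close>)
    next
      case False
      then have xi: "x i = 1" using xb[OF i] by simp
      have "((\<lambda>s. 1 - s * v i) \<longlongrightarrow> 1 - 0 * v i) (at_right 0)" by (intro tendsto_intros)
      then have "\<forall>\<^sub>F s in at_right 0. 0 < 1 - s * v i" by (intro order_tendstoD) auto
      with pos show ?thesis
        by eventually_elim (use xi i v[OF i] in \<open>auto simp: X_def Y_def\<close>)
    qed
  qed simp
  have cube: "\<forall>\<^sub>F s in at_right 0. X s \<in> cube d \<and> Y s \<in> cube d"
    using in01 by eventually_elim (auto simp: cube_def PiE_iff extensional_def X_def Y_def)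
  have viol: "\<forall>\<^sub>F s in at_right 0. \<forall>f\<in>F. f (Y s) < f (X s)"
  proof (intro eventually_ball_finite ballI fin)
    fix f assume "f \<in> F"
    then obtain p where p: "has_gradient d f x p" "(\<Sum>i<d. v i * p i) < 0" using rej by blast
    define q where "q = - (\<Sum>i<d. v i * p i)"
    define C where "C = L2_set v {..<d} + 1"
    have q: "0 < q" using p(2) by (simp add: q_def)
    have C: "0 < C" by (simp add: C_def add_nonneg_pos L2_set_nonneg)
    \<comment> \<open>The linear approximation errs by at most e s C at each endpoint, together s q
      / 2, which leaves half of the decrease s q.\<close>
    define e where "e = q / (4 * C)"
    have e: "0 < e" using q C by (simp add: e_def)
    obtain r where r: "0 < r" "\<And>y. y \<in> cube d \<Longrightarrow> eucl_dist d y x < r \<Longrightarrow>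
        \<bar>f y - f x - (\<Sum>i<d. p i * (y i - x i))\<bar> \<le> e * eucl_dist d y x"
      using p(1) e unfolding has_gradient_def by blast
    have "((\<lambda>s. s * C) \<longlongrightarrow> 0 * C) (at_right 0)" by (intro tendsto_intros)
    then have "\<forall>\<^sub>F s in at_right 0. s * C < r" using r(1) by (intro order_tendstoD) auto
    with pos cube show "\<forall>\<^sub>F s in at_right 0. f (Y s) < f (X s)"
    proof eventually_elim
      case (elim s)
      have dist: "eucl_dist d y x \<le> s * C" if "\<And>i. i < d \<Longrightarrow> \<bar>y i - x i\<bar> \<le> s * v i" for y
      proof -
        have "eucl_dist d y x = L2_set (\<lambda>i. \<bar>y i - x i\<bar>) {..<d}" by (simp add: eucl_dist_def L2_set_def)
        also have "\<dots> \<le> L2_set (\<lambda>i. s * v i) {..<d}" by (rule L2_set_mono) (use that in auto)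
        also have "\<dots> = s * L2_set v {..<d}" using elim(1) by (simp add: L2_set_right_distrib)
        also have "\<dots> \<le> s * C" using elim(1) by (simp add: C_def)
        finally show ?thesis .
      qed
      have dX: "eucl_dist d (X s) x \<le> s * C" and dY: "eucl_dist d (Y s) x \<le> s * C"
        using elim(1) v by (auto intro!: dist simp: X_def Y_def)
      have eX: "\<bar>f (X s) - f x - (\<Sum>i<d. p i * (X s i - x i))\<bar> \<le> e * (s * C)"
        using r(2)[of "X s"] elim dX e by (meson le_less_trans mult_left_mono less_imp_le order_trans)
      have eY: "\<bar>f (Y s) - f x - (\<Sum>i<d. p i * (Y s i - x i))\<bar> \<le> e * (s * C)"
        using r(2)[of "Y s"] elim dY e by (meson le_less_trans mult_left_mono less_imp_le order_trans)
      \<comment> \<open>In every coordinate the endpoints differ by exactly s v_i, whichever of them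
        was moved.\<close>
      have "(\<Sum>i<d. p i * (Y s i - x i)) - (\<Sum>i<d. p i * (X s i - x i)) = (\<Sum>i<d. s * (v i * p i))"
        unfolding sum_subtractf[symmetric] by (intro sum.cong) (auto simp: X_def Y_def algebra_simps)
      also have "\<dots> = - (s * q)" by (simp add: q_def sum_distrib_left)
      finally have "f (Y s) - f (X s) \<le> - (s * q) + 2 * (e * (s * C))" using eX eY by linarith
      also have "2 * (e * (s * C)) = s * q / 2" using C by (simp add: e_def)
      finally show ?case using mult_pos_pos[OF elim(1) q] by linarith
    qed
  qed
  have "\<forall>\<^sub>F s in at_right (0::real). 0 < s \<and> X s \<in> cube d \<and> Y s \<in> cube d \<and> (\<forall>f\<in>F. f (Y s) < f (X s))"
    using pos cube viol by eventually_elim auto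
  then obtain s where s: "0 < s" "X s \<in> cube d" "Y s \<in> cube d" "\<forall>f\<in>F. f (Y s) < f (X s)"
    using eventually_happens[of _ "at_right (0::real)"] by (auto simp: trivial_limit_at_right_real)
  moreover have "coord_le d (X s) (Y s)" using s(1) v by (auto simp: coord_le_def X_def Y_def)
  ultimately show ?thesis by blast
qed

section \<open>Averaging over a finite family\<close>

text \<open>Union bound over the samples, each of which has law \<open>D\<close>.\<close>

lemma reject_prob_le:
  assumes D: "prob_space D" and R: "{t \<in> space D. test_rejects d f t} \<in> sets D"
  shows "reject_prob d m D f \<le> real m * measure D {t \<in> space D. test_rejects d f t}"
proof -
  define R where "R = {t \<in> space D. test_rejects d f t}"
  have R [measurable]: "R \<in> sets D" using assms by (simp add: R_def)
  interpret S: prob_space "samples m D"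
    unfolding samples_def by (intro prob_space_PiM D)
  define E where "E i = (\<lambda>\<omega>. \<omega> i) -` R \<inter> space (samples m D)" for i
  have comp: "(\<lambda>\<omega>. \<omega> i) \<in> samples m D \<rightarrow>\<^sub>M D" if "i < m" for i
    unfolding samples_def by (rule measurable_component_singleton) (use that in simp)
  have E: "E i \<in> sets (samples m D)" if "i < m" for i
    unfolding E_def using comp[OF that] R by (rule measurable_sets)
  have ME: "measure (samples m D) (E i) = measure D R" if "i < m" for i
  proof -
    have "measure D R = measure (distr (samples m D) D (\<lambda>\<omega>. \<omega> i)) R"
      using distr_PiM_component[of "{..<m}" "\<lambda>_. D" i] D that by (simp add: samples_def)
    also have "\<dots> = measure (samples m D) (E i)"
      unfolding E_def by (rule measure_distr[OF comp[OF that] R])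
    finally show ?thesis by simp
  qed
  have "{\<omega> \<in> space (samples m D). \<exists>i<m. test_rejects d f (\<omega> i)} = (\<Union>i\<in>{..<m}. E i)"
    using measurable_space[OF comp] unfolding E_def R_def by blast
  then have "reject_prob d m D f = measure (samples m D) (\<Union>i\<in>{..<m}. E i)"
    by (simp only: reject_prob_def)
  also have "\<dots> \<le> (\<Sum>i<m. measure (samples m D) (E i))"
    by (rule S.finite_measure_subadditive_finite) (use E in auto)
  also have "\<dots> = real m * measure D R" by (simp add: ME)
  finally show ?thesis by (simp add: R_def)
qed

lemma le_query_complexity:
  assumes "prob_space D"
  shows "m \<le> query_complexity m D"
proof -
  interpret S: prob_space "samples m D"
    unfolding samples_def by (intro prob_space_PiM assms)
  obtain \<omega> where \<omega>: "\<omega> \<in> space (samples m D)" using S.not_empty by blast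
  have q: "1 \<le> test_queries t" "test_queries t \<le> 2" for t by (cases t; simp)+
  have "m = (\<Sum>i<m. 1)" by simp
  also have "\<dots> \<le> (\<Sum>i<m. test_queries (\<omega> i))" by (intro sum_mono q)
  also have "\<dots> \<le> query_complexity m D"
    unfolding query_complexity_def
  \<comment> \<open>A supremum of naturals bounds its members only if the set is bounded; every
    outcome costs at most 2 m queries.\<close>
  proof (rule cSUP_upper[OF \<omega>])
    have "(\<Sum>i<m. test_queries (\<omega> i)) \<le> 2 * m" for \<omega> :: "nat \<Rightarrow> mono_test"
      using sum_mono[of "{..<m}" "\<lambda>i. test_queries (\<omega> i)" "\<lambda>_. 2"] q by (simp add: mult.commute)
    then show "bdd_above ((\<lambda>\<omega>. \<Sum>i<m. test_queries (\<omega> i)) ` space (samples m D))"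
      by (intro bdd_aboveI2)
  qed
  finally show ?thesis .
qed

section \<open>Double counting over the secrets\<close>

text \<open>The index consists of the secret coordinate \<open>i\<close>, the position
  \<open>k\<close> of the interval and the place \<open>z\<close> of the bump. \<open>Z\<close> and
  \<beta> stay abstract so that both regimes are instances: \<beta> bounds the fraction of
  \<open>Z\<close> whose bump is active at a given point.\<close>

context
  fixes d :: nat and M w \<rho> \<beta> :: real and L :: nat and Z :: "'z set"
    and \<phi> :: "nat \<Rightarrow> 'z \<Rightarrow> (nat \<Rightarrow> real) \<Rightarrow> real" and f :: "nat \<times> nat \<times> 'z \<Rightarrow> (nat \<Rightarrow> real) \<Rightarrow> real"
    and I :: "(nat \<times> nat \<times> 'z) set"
  assumes d: "1 \<le> d" and M: "0 < M" and w: "\<rho> / sqrt (real d) \<le> w" "w \<le> 1/4" and \<rho>: "0 < \<rho>"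
    and Z: "finite Z" "Z \<noteq> {}"
    and amp: "\<And>i z. i < d \<Longrightarrow> z \<in> Z \<Longrightarrow> amplitude d M i w (\<phi> i z)"
    and supp: "\<And>i x. i < d \<Longrightarrow> x \<in> cube d \<Longrightarrow> real (card {z \<in> Z. 0 < \<phi> i z x}) \<le> \<beta> * real (card Z)"
  defines "f \<equiv> \<lambda>(i, k, z). hard d (M / (4 * sqrt (real d))) i (1/4 + real k * w) w (\<phi> i z)"
    and "I \<equiv> {..<d} \<times> {..<L} \<times> Z"
begin

lemma w_pos: "0 < w"
  using d \<rho> by (intro less_le_trans[OF _ w(1)]) simp

text \<open>A violation confines \<open>i\<close> and \<open>k\<close> to the sets counted in
  \<open>sum_card_violations_le\<close> and, separately, \<open>z\<close> to the bumps active at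
  \<open>x\<close>. The two counts multiply.\<close>

lemma card_violated_by_pair_le:
  assumes x: "x \<in> cube d" and y: "y \<in> cube d" and le: "coord_le d x y"
  shows "real (card {n \<in> I. f n y < f n x}) \<le> (1 / \<rho> + 14) * sqrt (real d) * (\<beta> * real (card Z))"
proof -
  define H where "H i = (\<Sum>j\<in>{..<d} - {i}. y j - x j)" for i
  define K where "K i = {k. k < L \<and> x i - w < 1/4 + real k * w \<and> 1/4 + real k * w < y i \<and>
     H i < 4 * sqrt (real d) * w \<and> H i < 4 * sqrt (real d) * (y i - x i)}" for i
  define B where "B i = {z \<in> Z. 0 < \<phi> i z x}" for i
  have fin: "finite (K i)" "finite (B i)" for i using Z by (auto simp: K_def B_def)
  have "{n \<in> I. f n y < f n x} \<subseteq> (SIGMA i:{..<d}. K i \<times> B i)"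
  proof
    fix n assume "n \<in> {n \<in> I. f n y < f n x}"
    moreover obtain i k z where n: "n = (i, k, z)" by (cases n) auto
    ultimately have n': "i < d" "k < L" "z \<in> Z"
      and rej: "hard d (M / (4 * sqrt (real d))) i (1/4 + real k * w) w (\<phi> i z) y
        < hard d (M / (4 * sqrt (real d))) i (1/4 + real k * w) w (\<phi> i z) x"
      by (auto simp: I_def f_def)
    from hard_violation[OF n'(1) M w_pos amp[OF n'(1,3)] le rej]
    show "n \<in> (SIGMA i:{..<d}. K i \<times> B i)"
      using n' by (auto simp: n K_def B_def H_def)
  qed
  then have "card {n \<in> I. f n y < f n x} \<le> card (SIGMA i:{..<d}. K i \<times> B i)"
    by (intro card_mono) (auto intro: fin)
  also have "\<dots> = (\<Sum>i<d. card (K i) * card (B i))"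
    by (simp add: fin card_SigmaI card_cartesian_product)
  finally have "real (card {n \<in> I. f n y < f n x}) \<le> (\<Sum>i<d. real (card (K i)) * real (card (B i)))"
    by (simp flip: of_nat_mult of_nat_sum)
  also have "\<dots> \<le> (\<Sum>i<d. real (card (K i)) * (\<beta> * real (card Z)))"
    using supp x by (intro sum_mono mult_left_mono) (auto simp: B_def)
  also have "\<dots> = real (\<Sum>i<d. card (K i)) * (\<beta> * real (card Z))"
    by (simp add: sum_distrib_right)
  also have "\<dots> \<le> (1 / \<rho> + 14) * sqrt (real d) * (\<beta> * real (card Z))"
  proof (rule mult_right_mono)
    show "real (\<Sum>i<d. card (K i)) \<le> (1 / \<rho> + 14) * sqrt (real d)"
      unfolding K_def H_def by (rule sum_card_violations_le[OF d w(1) \<rho> x y le])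
    \<comment> \<open>Read off the support bound, which has a cardinality on its left; coordinate 0
      exists because \<open>d\<close> is positive.\<close>
    show "0 \<le> \<beta> * real (card Z)"
      using supp[of 0 x] d x by (meson of_nat_0_le_iff order_trans le_simps(3) One_nat_def less_le_trans zero_less_one)
  qed
  finally show ?thesis .
qed

text \<open>A derivative test is replaced by a single pair that violates all members it rejects;
  finiteness of the family allows one pair for all of them.\<close>

lemma card_rejected_le:
  assumes "legal_test d t"
  shows "real (card {n \<in> I. test_rejects d (f n) t}) \<le> (1 / \<rho> + 14) * sqrt (real d) * (\<beta> * real (card Z))"
proof (cases t)
  case (Pair_Test x y)
  then show ?thesis using assms card_violated_by_pair_le[of x y] by simp
next
  case (Deriv_Test x v)
  define N where "N = {n \<in> I. test_rejects d (f n) t}"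
  have finI: "finite I" using Z by (simp add: I_def)
  have "\<exists>x'\<in>cube d. \<exists>y'\<in>cube d. coord_le d x' y' \<and> (\<forall>g\<in>f ` N. g y' < g x')"
    using assms Deriv_Test finI
    by (intro deriv_violation_imp_pair_violation[of _ x _ v]) (auto simp: N_def)
  then obtain x' y' where xy: "x' \<in> cube d" "y' \<in> cube d" "coord_le d x' y'" "\<forall>n\<in>N. f n y' < f n x'"
    by auto
  have "card N \<le> card {n \<in> I. f n y' < f n x'}"
    using finI xy(4) by (intro card_mono) (auto simp: N_def)
  then show ?thesis using card_violated_by_pair_le[OF xy(1-3)] by (simp add: N_def)
qed

text \<open>The rejection probabilities of single tests sum to the expected number of rejected
  members, which is at most \<open>B\<close>, while \<open>m\<close> times each of them is at least
  2/3. The family has d L |Z| members with L \<ge> 1 / (4 w), and |Z| cancels.\<close>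

lemma tester_samples_ge:
  assumes far: "\<And>n. n \<in> I \<Longrightarrow> \<epsilon> \<le> dist_mono1 d (f n)" and L: "1 / (4 * w) \<le> real L"
    and tester: "L1_derivative_pair_tester d M \<epsilon> m D"
  shows "2 / 3 \<le> real m * ((1 / \<rho> + 14) * \<beta> * (4 * w) / sqrt (real d))"
proof -
  define B where "B = (1 / \<rho> + 14) * sqrt (real d) * (\<beta> * real (card Z))"
  define R where "R n = {t \<in> space D. test_rejects d (f n) t}" for n
  have finI: "finite I" using Z by (simp add: I_def)
  have cI: "real (card I) = real d * real L * real (card Z)" by (simp add: I_def card_cartesian_product)
  have D: "prob_space D" "\<And>t. t \<in> space D \<Longrightarrow> legal_test d t"
    and meas: "\<And>g. lipschitz_cube d M g \<Longrightarrow> {t \<in> space D. test_rejects d g t} \<in> sets D"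
    and rej: "\<And>g. lipschitz_cube d M g \<Longrightarrow> \<epsilon> \<le> dist_mono1 d g \<Longrightarrow> 2 / 3 \<le> reject_prob d m D g"
    using tester by (auto simp: L1_derivative_pair_tester_def test_distribution_def)
  interpret D: prob_space D by (rule D)
  have lip: "lipschitz_cube d M (f n)" if "n \<in> I" for n
    using that amp lipschitz_hard[OF _ M w_pos] by (auto simp: I_def f_def)
  have R: "R n \<in> sets D" if "n \<in> I" for n unfolding R_def by (rule meas[OF lip[OF that]])
  have "(\<Sum>n\<in>I. measure D (R n)) = (\<Sum>n\<in>I. \<integral>t. indicator (R n) t \<partial>D)"
    using R by (intro sum.cong) auto
  also have "\<dots> = (\<integral>t. (\<Sum>n\<in>I. indicator (R n) t) \<partial>D)"
    using R by (intro Bochner_Integration.integral_sum[symmetric]) (auto simp: D.emeasure_eq_measure)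
  also have "\<dots> \<le> (\<integral>t. B \<partial>D)"
  proof (rule integral_mono)
    show "integrable D (\<lambda>t. \<Sum>n\<in>I. indicator (R n) t :: real)"
      using R by (intro Bochner_Integration.integrable_sum) (auto simp: D.emeasure_eq_measure)
    fix t assume t: "t \<in> space D"
    have "(\<Sum>n\<in>I. indicator (R n) t) = real (card {n \<in> I. test_rejects d (f n) t})"
      using t finI by (simp add: R_def indicator_def sum.If_cases Int_def)
    also have "\<dots> \<le> B" unfolding B_def by (rule card_rejected_le[OF D(2)[OF t]])
    finally show "(\<Sum>n\<in>I. indicator (R n) t) \<le> B" .
  qed simp
  also have "\<dots> = B" by (simp add: D.prob_space)
  finally have sumR: "(\<Sum>n\<in>I. measure D (R n)) \<le> B" .
  have "(\<Sum>n\<in>I. 2 / 3) \<le> (\<Sum>n\<in>I. real m * measure D (R n))"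
  proof (rule sum_mono)
    fix n assume n: "n \<in> I"
    show "2 / 3 \<le> real m * measure D (R n)"
      using rej[OF lip[OF n] far[OF n]] reject_prob_le[OF D(1) R[OF n, unfolded R_def], of m]
      by (simp add: R_def)
  qed
  also have "\<dots> \<le> real m * B" using sumR by (simp add: mult_left_mono flip: sum_distrib_left)
  finally have 1: "2 / 3 * real (card I) \<le> real m * B" by simp
  have cZ: "0 < real (card Z)" using Z by (simp add: card_gt_0_iff)
  have sd: "0 < sqrt (real d)" "sqrt (real d) * sqrt (real d) = real d" using d by auto
  have "2 / 3 * (real d * (1 / (4 * w)) * real (card Z)) \<le> 2 / 3 * real (card I)"
    unfolding cI using L by (intro mult_left_mono mult_right_mono) auto
  with 1 have "2 / 3 * (real d * (1 / (4 * w)) * real (card Z)) \<le> real m * B" by linarith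
  then have "(2 / 3) * (real d * real (card Z)) \<le> (real m * B) * (4 * w)"
    using w_pos by (simp add: field_simps)
  then have "(2 / 3) * real d \<le> real m * ((1 / \<rho> + 14) * \<beta> * (4 * w)) * sqrt (real d)"
    using cZ unfolding B_def by (simp add: mult_ac)
  also have "\<dots> = (real m * ((1 / \<rho> + 14) * \<beta> * (4 * w) / sqrt (real d))) * (sqrt (real d) * sqrt (real d))"
    using sd(1) by (simp del: real_sqrt_mult_self)
  also have "\<dots> = (real m * ((1 / \<rho> + 14) * \<beta> * (4 * w) / sqrt (real d))) * real d"
    by (simp only: sd(2))
  finally show ?thesis by (rule mult_right_le_imp_le) (use d in simp)
qed

end

section \<open>The two regimes\<close>

text \<open>A discrete substitute for continuity: among the radii (n / 2) / l^k take the last one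
  before the volume first falls below \<delta>. The next radius has volume below \<delta>, so
  \<open>ballvol_scale\<close> bounds this one by l^n \<delta>.\<close>

lemma ballvol_radius_exists:
  assumes n: "1 \<le> n" and \<delta>: "0 < \<delta>" "\<delta> \<le> 1" and l: "1 < l"
  shows "\<exists>\<theta>>0. \<theta> \<le> real n / 2 \<and> ennreal \<delta> \<le> ballvol n \<theta> \<and> ballvol n \<theta> \<le> ennreal (l ^ n * \<delta>)"
proof -
  define r where "r k = (real n / 2) / l ^ k" for k
  have r: "0 < r k" "r k \<le> real n / 2" for k
    using n l by (auto simp: r_def divide_le_eq mult_le_cancel_left1)
  \<comment> \<open>Then exp 1 (2 / t) = e \<delta> / 3 < \<delta>, so the Chernoff bound puts the
    volume below \<delta> as soon as t r \<le> 1.\<close>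
  define t where "t = 6 / \<delta>"
  have t: "0 < t" "2 / t \<le> 1" "exp 1 * (2 / t) < \<delta>"
    using \<delta> exp_less_cancel_iff[of 1 1] e_less_272 by (auto simp: t_def field_simps)
  obtain k0 where "real n * t < l ^ k0" using real_arch_pow[OF l] by blast
  moreover have "0 < l ^ k0" using l by simp
  ultimately have "t * r k0 \<le> 1" by (simp add: r_def divide_le_eq mult_ac)
  have "ballvol n (r k0) \<le> ennreal (exp (t * r k0) * (2 / t) ^ n)" by (rule ballvol_chernoff[OF t(1)])
  also have "exp (t * r k0) * (2 / t) ^ n \<le> exp 1 * (2 / t)"
    using \<open>t * r k0 \<le> 1\<close> t n power_decreasing[OF n, of "2 / t"] by (intro mult_mono) auto
  finally have "ballvol n (r k0) \<le> ennreal (exp 1 * (2 / t))" by (simp add: ennreal_leI)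
  then have ex: "ballvol n (r k0) < ennreal \<delta>"
    using t(3) t(1) by (meson ennreal_lessI \<delta>(1) le_less_trans)
  define k where "k = (LEAST k. ballvol n (r k) < ennreal \<delta>)"
  have k: "ballvol n (r k) < ennreal \<delta>" unfolding k_def by (rule LeastI[of _ k0]) (rule ex)
  \<comment> \<open>The initial radius n / 2 already covers the whole torus.\<close>
  have "k \<noteq> 0"
  proof
    assume "k = 0"
    then have "ballvol n (r k) = 1" by (intro ballvol_eq_1) (simp add: r_def)
    then show False using k \<delta> by (simp add: not_less)
  qed
  then obtain k' where k': "k = Suc k'" by (cases k) auto
  have "ennreal \<delta> \<le> ballvol n (r k')"
    using not_less_Least[of k' "\<lambda>k. ballvol n (r k) < ennreal \<delta>"] k' by (simp add: k_def not_less)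
  moreover have "ballvol n (r k') \<le> ennreal (l ^ n * \<delta>)"
  proof -
    have "r k' = l * r k" using l by (simp add: r_def k')
    then have "ballvol n (r k') \<le> ennreal (l ^ n) * ballvol n (r k)"
      using ballvol_scale[of l n "r k"] l by simp
    also have "\<dots> \<le> ennreal (l ^ n) * ennreal \<delta>" using k by (intro mult_left_mono) auto
    also have "\<dots> = ennreal (l ^ n * \<delta>)" using l \<delta> by (simp add: ennreal_mult)
    finally show ?thesis .
  qed
  ultimately show ?thesis using r[of k'] by blast
qed

text \<open>Chernoff with t = 1 / (4 \<rho>) and n = d - 1. For \<theta> < 4 \<rho> d the
  exponential factor is at most exp d, and (8 \<rho>)^n = exp (- 2 (K + 2) n) is at most exp (- (K +
  2) d) because d \<le> 2 n. The product exp (- (K + 1) d) is too small.\<close>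

lemma ballvol_radius_ge:
  assumes d: "2 \<le> d" and K: "0 \<le> K" and V: "exp (- K * real d) \<le> v" "ennreal v \<le> ballvol (d - 1) \<theta>"
  shows "4 * (exp (- 2 * (K + 2)) / 8) * real d \<le> \<theta>"
proof (rule ccontr)
  define \<rho> where "\<rho> = exp (- 2 * (K + 2)) / 8"
  define n where "n = d - 1"
  assume "\<not> ?thesis"
  then have lt: "\<theta> < 4 * \<rho> * real d" by (simp add: \<rho>_def)
  have \<rho>: "0 < \<rho>" by (simp add: \<rho>_def)
  have n: "real d \<le> 2 * real n" using d by (simp add: n_def of_nat_diff)
  have "ballvol n \<theta> \<le> ennreal (exp (1 / (4 * \<rho>) * \<theta>) * (2 / (1 / (4 * \<rho>))) ^ n)"
    by (rule ballvol_chernoff) (use \<rho> in simp)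
  also have "\<dots> \<le> ennreal (exp (real d) * exp (- (K + 2) * real d))"
  proof (intro ennreal_leI mult_mono)
    show "exp (1 / (4 * \<rho>) * \<theta>) \<le> exp (real d)" using lt \<rho> by (simp add: field_simps)
    have "(2 / (1 / (4 * \<rho>))) ^ n = exp (real n * (- 2 * (K + 2)))"
      unfolding exp_of_nat_mult by (simp add: \<rho>_def)
    also have "\<dots> \<le> exp (- (K + 2) * real d)"
      using mult_left_mono[OF n, of "K + 2"] K by (simp add: algebra_simps)
    finally show "(2 / (1 / (4 * \<rho>))) ^ n \<le> exp (- (K + 2) * real d)" .
  qed (use \<rho> in auto)
  also have "\<dots> < ennreal (exp (- K * real d))"
    using d by (intro ennreal_lessI) (auto simp: mult_exp_exp algebra_simps)
  also have "\<dots> \<le> ennreal v" using V by (intro ennreal_leI) simp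
  finally show False using V by (simp add: n_def)
qed

section \<open>Bumps on torus balls\<close>

definition torus_dist :: "nat \<Rightarrow> nat \<Rightarrow> nat \<Rightarrow> (nat \<Rightarrow> nat) \<Rightarrow> (nat \<Rightarrow> real) \<Rightarrow> real" where
  "torus_dist d i N z x = (\<Sum>j\<in>{..<d} - {i}. tri (x j - real (z j) / real N))"

text \<open>Full height on the ball of radius \<theta>, zero outside radius \<theta> (1 + 1 / d):
  the slope M / (8 sqrt d) in l1 distance gains exactly the height across the shell of thickness
  \<theta> / d. The height is M w / 2 for w = \<theta> / (4 d sqrt d).\<close>

definition bump :: "nat \<Rightarrow> real \<Rightarrow> real \<Rightarrow> nat \<Rightarrow> nat \<Rightarrow> (nat \<Rightarrow> nat) \<Rightarrow> (nat \<Rightarrow> real) \<Rightarrow> real" where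
  "bump d M \<theta> N i z x = max 0 (min (M / (8 * sqrt (real d)) * (\<theta> / real d))
     (M / (8 * sqrt (real d)) * (\<theta> * (1 + 1 / real d) - torus_dist d i N z x)))"

lemma torus_dist_lipschitz:
  "\<bar>torus_dist d i N z x - torus_dist d i N z y\<bar> \<le> (\<Sum>j\<in>{..<d} - {i}. \<bar>x j - y j\<bar>)"
proof -
  have "\<bar>torus_dist d i N z x - torus_dist d i N z y\<bar>
      \<le> (\<Sum>j\<in>{..<d} - {i}. \<bar>tri (x j - real (z j) / real N) - tri (y j - real (z j) / real N)\<bar>)"
    unfolding torus_dist_def sum_subtractf[symmetric] by (rule sum_abs)
  also have "\<dots> \<le> (\<Sum>j\<in>{..<d} - {i}. \<bar>x j - y j\<bar>)"
  proof (rule sum_mono)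
    show "\<bar>tri (x j - real (z j) / real N) - tri (y j - real (z j) / real N)\<bar> \<le> \<bar>x j - y j\<bar>" for j
      using tri_lipschitz[of "x j - real (z j) / real N" "y j - real (z j) / real N"] by simp
  qed
  finally show ?thesis .
qed

lemma amplitude_bump:
  assumes M: "0 < M" and d: "1 \<le> d" and \<theta>: "0 < \<theta>"
  shows "amplitude d M i (\<theta> / (4 * real d * sqrt (real d))) (bump d M \<theta> N i z)"
proof -
  define c where "c = M / (8 * sqrt (real d))"
  have c: "0 < c" using M d by (simp add: c_def)
  have A: "M * (\<theta> / (4 * real d * sqrt (real d))) / 2 = c * (\<theta> / real d)"
    by (simp add: c_def)
  have "0 \<le> c * (\<theta> / real d)" using c \<theta> by simp
  then have 1: "0 \<le> bump d M \<theta> N i z x \<and> bump d M \<theta> N i z x \<le> c * (\<theta> / real d)" for x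
    by (simp add: bump_def c_def)
  have 2: "\<bar>bump d M \<theta> N i z x - bump d M \<theta> N i z y\<bar> \<le> c * (\<Sum>j\<in>{..<d} - {i}. \<bar>x j - y j\<bar>)" for x y
  proof -
    have "\<bar>bump d M \<theta> N i z x - bump d M \<theta> N i z y\<bar>
       \<le> \<bar>c * (\<theta> * (1 + 1 / real d) - torus_dist d i N z x) - c * (\<theta> * (1 + 1 / real d) - torus_dist d i N z y)\<bar>"
      unfolding bump_def c_def[symmetric] by linarith
    also have "\<dots> = c * \<bar>torus_dist d i N z x - torus_dist d i N z y\<bar>"
      using c by (simp add: abs_mult abs_minus_commute flip: right_diff_distrib)
    also have "\<dots> \<le> c * (\<Sum>j\<in>{..<d} - {i}. \<bar>x j - y j\<bar>)"
      using c by (intro mult_left_mono torus_dist_lipschitz) simp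
    finally show ?thesis .
  qed
  show ?thesis unfolding amplitude_def A using 1 2 by (simp add: c_def)
qed

text \<open>The distance ignores z_i, so this component is free and contributes a factor
  \<open>N\<close>. Keeping it lets one set of centres serve every secret coordinate.\<close>

lemma card_torus_ball_le:
  assumes i: "i < d" and N: "0 < N" and x: "x \<in> cube d"
  shows "of_nat (card {z \<in> {..<d} \<rightarrow>\<^sub>E {..<N}. torus_dist d i N z x \<le> r})
      \<le> of_nat (N ^ d) * ballvol (d - 1) (r + real (d - 1) / real N)"
proof -
  define J where "J = {..<d} - {i}"
  have J: "finite J" "{..<d} = insert i J" "card J = d - 1" using i by (auto simp: J_def)
  define S where "S = {z \<in> J \<rightarrow>\<^sub>E {..<N}. torus_dist d i N z x \<le> r}"
  have fin: "finite S"
    unfolding S_def by (rule finite_subset[of _ "J \<rightarrow>\<^sub>E {..<N}"]) (auto intro: finite_PiE J)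
  have sub: "{z \<in> {..<d} \<rightarrow>\<^sub>E {..<N}. torus_dist d i N z x \<le> r} \<subseteq> (\<lambda>(k, g). g(i := k)) ` ({..<N} \<times> S)"
    (is "?L \<subseteq> ?R")
  proof
    fix z assume z: "z \<in> ?L"
    define g where "g = z(i := undefined)"
    have "g \<in> J \<rightarrow>\<^sub>E {..<N}" using z by (auto simp: g_def J_def PiE_iff extensional_def)
    moreover have "torus_dist d i N g x = torus_dist d i N z x"
      unfolding torus_dist_def by (intro sum.cong) (auto simp: g_def)
    ultimately have "(z i, g) \<in> {..<N} \<times> S" using z i by (auto simp: S_def)
    moreover have "z = (\<lambda>(k, g). g(i := k)) (z i, g)" by (simp add: g_def)
    ultimately show "z \<in> ?R" by (rule rev_image_eqI)
  qed
  have "card ?L \<le> card ?R" by (intro card_mono sub) (auto intro: fin)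
  also have "\<dots> \<le> card ({..<N} \<times> S)" by (rule card_image_le) (auto intro: fin)
  also have "\<dots> = N * card S" by (simp add: card_cartesian_product)
  finally have "of_nat (card ?L) \<le> (of_nat (N * card S) :: ennreal)" by (rule of_nat_mono)
  also have "\<dots> = of_nat N * of_nat (card S)" by simp
  also have "\<dots> \<le> of_nat N * (of_nat (N ^ (d - 1)) * ballvol (d - 1) (r + real (d - 1) / real N))"
  proof (intro mult_left_mono)
    have "0 \<le> x j \<and> x j \<le> 1" if "j \<in> J" for j using x that by (auto simp: J_def cube_def PiE_iff)
    from card_grid_ball_le[OF J(1) N this, where \<theta>=r]
    show "of_nat (card S) \<le> of_nat (N ^ (d - 1)) * ballvol (d - 1) (r + real (d - 1) / real N)"
      by (simp only: S_def torus_dist_def J_def[symmetric] J(3))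
  qed simp
  also have "\<dots> = of_nat (N ^ d) * ballvol (d - 1) (r + real (d - 1) / real N)"
    using i by (cases d) (auto simp: mult.assoc)
  finally show ?thesis .
qed

lemma nn_integral_slab_unit_product:
  fixes G :: "(nat \<Rightarrow> real) \<Rightarrow> ennreal"
  assumes i: "i < d"
    and "G \<in> borel_measurable (\<Pi>\<^sub>M j\<in>{..<d}. unit_measure)"
      "G \<in> borel_measurable (\<Pi>\<^sub>M j\<in>{..<d} - {i}. unit_measure)"
    and indep: "\<And>x y. G (x(i := y)) = G x"
  shows "(\<integral>\<^sup>+x. G x * indicator ({..1/4} \<union> {3/4..}) (x i) \<partial>(\<Pi>\<^sub>M j\<in>{..<d}. unit_measure))
       = (\<integral>\<^sup>+x. G x \<partial>(\<Pi>\<^sub>M j\<in>{..<d} - {i}. unit_measure)) / 2"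
proof -
  have "insert i ({..<d} - {i}) = {..<d}" using i by auto
  with nn_integral_slab[of "{..<d} - {i}" i G] assms show ?thesis by simp
qed

lemma torus_dist_borel:
  assumes "{..<d} - {i} \<subseteq> I"
  shows "torus_dist d i N z \<in> borel_measurable (\<Pi>\<^sub>M j\<in>I. unit_measure)"
  unfolding torus_dist_def[abs_def]
  using assms by (intro borel_measurable_sum measurable_compose[OF _ tri_borel] borel_measurable_diff coordinate_borel) auto

section \<open>The two ranges of \<epsilon>\<close>

text \<open>Constant bump, one-element \<open>Z\<close>, \<beta> = 1. With w = 8 \<epsilon> / M and
  v = 1/2 the distance bound is M w / 8 = \<epsilon>; the hypothesis \<open>le\<close> says w \<ge>
  \<rho> / sqrt d, and \<epsilon> \<le> M / 32 says w \<le> 1/4.\<close>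

lemma tester_samples_ge_large_eps:
  assumes d: "1 \<le> d" and M: "0 < M" and \<epsilon>: "0 < \<epsilon>" "\<epsilon> \<le> M / 32" and \<rho>: "0 < \<rho>"
    and le: "M / \<epsilon> \<le> 8 * sqrt (real d) / \<rho>"
    and tester: "L1_derivative_pair_tester d M \<epsilon> m D"
  shows "2 / 3 \<le> real m * ((1 / \<rho> + 14) * 32 * \<epsilon> / (M * sqrt (real d)))"
proof -
  define w where "w = 8 * \<epsilon> / M"
  \<comment> \<open>As many adjacent intervals of length \<open>w\<close> as fit into
    [1/4, 3/4].\<close>
  define L where "L = nat \<lfloor>1 / (2 * w)\<rfloor>"
  define \<phi> :: "nat \<Rightarrow> unit \<Rightarrow> (nat \<Rightarrow> real) \<Rightarrow> real" where "\<phi> i z x = M * w / 2" for i z x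
  have w: "0 < w" "w \<le> 1/4" "\<rho> / sqrt (real d) \<le> w"
    using M \<epsilon> le \<rho> d by (auto simp: w_def field_simps)
  have amp: "amplitude d M i w (\<phi> i z)" for i z
    using M w by (auto simp: amplitude_def \<phi>_def intro!: mult_nonneg_nonneg sum_nonneg divide_nonneg_nonneg)
  have far: "\<epsilon> \<le> dist_mono1 d (hard d a i (1/4 + real k * w) w (\<phi> i z))" if "i < d" "k < L" for a i k z
  proof -
    have "real k + 1 \<le> 1 / (2 * w)" using that(2) w by (simp add: L_def) linarith
    then have "(real k + 1) * w \<le> 1 / 2" using w by (simp add: field_simps)
    then have \<zeta>: "1/4 \<le> 1/4 + real k * w" "1/4 + real k * w + w \<le> 3/4" using w by (auto simp: algebra_simps)
    have "(\<integral>\<^sup>+x. 1 * indicator ({..1/4} \<union> {3/4..}) (x i) \<partial>(\<Pi>\<^sub>M j\<in>{..<d}. unit_measure)) = (1 / 2 :: ennreal)"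
    proof -
      have "(\<integral>\<^sup>+x. 1 \<partial>(\<Pi>\<^sub>M j\<in>{..<d} - {i}. unit_measure)) = 1"
        unfolding nn_integral_const prob_space.emeasure_space_1[OF prob_space_unit_product] by simp
      moreover have "(\<integral>\<^sup>+x. 1 * indicator ({..1/4} \<union> {3/4..}) (x i) \<partial>(\<Pi>\<^sub>M j\<in>{..<d}. unit_measure))
        = (\<integral>\<^sup>+x. 1 \<partial>(\<Pi>\<^sub>M j\<in>{..<d} - {i}. unit_measure)) / 2"
        by (rule nn_integral_slab_unit_product[OF that(1)]) (rule borel_measurable_const refl)+
      ultimately show ?thesis by (simp only:)
    qed
    also have "(1 / 2 :: ennreal) = ennreal (1/2)" using divide_ennreal[of 1 2] by simp
    finally have half: "(\<integral>\<^sup>+x. 1 * indicator ({..1/4} \<union> {3/4..}) (x i) \<partial>(\<Pi>\<^sub>M j\<in>{..<d}. unit_measure)) = ennreal (1/2)" .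
    have one: "indicator {M * w / 2..} (\<phi> i z x) = (1 :: ennreal)" for x by (simp add: \<phi>_def)
    have "M * w * (1/2) / 4 \<le> dist_mono1 d (hard d a i (1/4 + real k * w) w (\<phi> i z))"
    proof (rule dist_mono1_hard_ge[OF that(1) M w(1) \<zeta> amp])
      show "\<phi> i z \<in> borel_measurable (\<Pi>\<^sub>M j\<in>{..<d}. unit_measure)" by (simp add: \<phi>_def[abs_def])
      show "ennreal (1/2) \<le> (\<integral>\<^sup>+x. indicator {M * w / 2..} (\<phi> i z x) * indicator ({..1/4} \<union> {3/4..}) (x i)
          \<partial>(\<Pi>\<^sub>M j\<in>{..<d}. unit_measure))"
        unfolding one half by (rule order_refl)
    qed simp
    then show ?thesis using M by (simp add: w_def)
  qed
  \<comment> \<open>Rounding down loses at most half, because 1 / (2 w) is at least 2.\<close>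
  have L: "1 / (4 * w) \<le> real L"
  proof -
    have "2 \<le> 1 / (2 * w)" using w by (simp add: field_simps)
    moreover have "1 / (2 * w) = 2 * (1 / (4 * w))" by simp
    ultimately show ?thesis unfolding L_def by linarith
  qed
  have "2 / 3 \<le> real m * ((1 / \<rho> + 14) * 1 * (4 * w) / sqrt (real d))"
    by (rule tester_samples_ge[where Z="UNIV :: unit set" and \<phi>=\<phi> and L=L, OF d M w(3,2) \<rho> _ _ amp _ _ L tester])
       (use far in \<open>auto simp: card_UNIV_unit\<close>)
  also have "(1 / \<rho> + 14) * 1 * (4 * w) / sqrt (real d) = (1 / \<rho> + 14) * 32 * \<epsilon> / (M * sqrt (real d))"
    by (simp add: w_def)
  finally show ?thesis .
qed

lemma one_plus_inverse_power_le_exp: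
  fixes c :: real
  assumes "0 \<le> c" "1 \<le> d" "n \<le> d"
  shows "(1 + c / real d) ^ n \<le> exp c"
proof -
  have "(1 + c / real d) ^ n \<le> exp (c / real d) ^ n"
    using assms by (intro power_mono exp_ge_add_one_self) auto
  also have "\<dots> = exp (real n * (c / real d))" by (simp only: exp_of_nat_mult)
  also have "\<dots> \<le> exp c"
    using assms mult_right_mono[of "real n" "real d" c] by (simp add: field_simps)
  finally show ?thesis .
qed

text \<open>With \<open>w\<close> of order 1 / sqrt d, localising the fall to a ball of volume about
  \<delta> scales the distance and the success probability alike. The value of \<rho> is the one for
  which \<open>ballvol_radius_ge\<close> yields w \<ge> \<rho> / sqrt d.\<close>

lemma tester_samples_ge_small_eps:
  fixes K :: real
  defines "\<rho> \<equiv> exp (- 2 * (K + 2)) / 8"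
  assumes K: "0 \<le> K" and d: "1 \<le> d" and M: "0 < M" and \<epsilon>: "0 < \<epsilon>"
    and le: "8 * sqrt (real d) / \<rho> \<le> M / \<epsilon>" "M / \<epsilon> \<le> exp (K * real d)"
    and tester: "L1_derivative_pair_tester d M \<epsilon> m D"
  shows "2 / 3 \<le> real m * ((1 / \<rho> + 14) * (4 * exp 3 / \<rho>) * \<epsilon> / (M * sqrt (real d)))"
proof -
  have "exp (- 2 * (K + 2)) \<le> 1" using K by simp
  then have \<rho>: "0 < \<rho>" "\<rho> \<le> 1" unfolding \<rho>_def by (simp, linarith)
  have sd: "1 \<le> sqrt (real d)" using d by simp
  \<comment> \<open>In dimension one no other coordinate could carry a ball, but there the two
    bounds on M / \<epsilon> are contradictory.\<close>
  have d2: "2 \<le> d"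
  proof (rule ccontr)
    assume "\<not> ?thesis"
    then have "d = 1" using d by simp
    then have "8 / \<rho> \<le> exp K" using le by simp
    moreover have "8 / \<rho> = 64 * exp (2 * K + 4)"
    proof -
      have "exp (2 * K + 4) * exp (- 2 * (K + 2)) = 1" by (simp add: mult_exp_exp algebra_simps)
      then show ?thesis by (simp add: \<rho>_def divide_eq_eq)
    qed
    moreover have "exp K \<le> exp (2 * K + 4)" using K by simp
    moreover have "0 < exp (2 * K + 4)" by simp
    ultimately show False by linarith
  qed
  \<comment> \<open>Solves M (\<rho> / sqrt d) (\<delta> / 2) / 4 = \<epsilon>. The lower bound on M
    / \<epsilon> gives \<delta> \<le> 1, the upper one \<delta> \<ge> exp (- K d).\<close>
  define \<delta> where "\<delta> = 8 * \<epsilon> * sqrt (real d) / (M * \<rho>)"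
  have \<delta>: "0 < \<delta>" "\<delta> \<le> 1"
  proof -
    show "0 < \<delta>" using M \<epsilon> \<rho> d by (simp add: \<delta>_def)
    have "\<delta> = (8 * sqrt (real d) / \<rho>) / (M / \<epsilon>)" by (simp add: \<delta>_def mult_ac)
    also have "\<dots> \<le> 1" using le(1) M \<epsilon> by (simp only: divide_le_eq_1_pos divide_pos_pos)
    finally show "\<delta> \<le> 1" .
  qed
  have \<delta>K: "exp (- K * real d) \<le> \<delta>"
  proof -
    have "exp (- K * real d) = 1 / exp (K * real d)" by (simp add: exp_minus inverse_eq_divide)
    also have "\<dots> \<le> 1 / (M / \<epsilon>)" using le M \<epsilon> by (intro divide_left_mono) auto
    also have "\<dots> = \<epsilon> / M * 1" by simp
    also have "\<dots> \<le> \<epsilon> / M * (8 * sqrt (real d) / \<rho>)"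
    proof (rule mult_left_mono)
      have "\<rho> \<le> 8 * sqrt (real d)" using \<rho> sd by linarith
      then show "1 \<le> 8 * sqrt (real d) / \<rho>" using \<rho> by (simp only: le_divide_eq_1_pos)
    qed (use M \<epsilon> in simp)
    also have "\<dots> = \<delta>" by (simp add: \<delta>_def)
    finally show ?thesis .
  qed
  \<comment> \<open>The ratio 1 + 1 / d keeps the overshoot of the volume below a factor e.\<close>
  obtain \<theta> where \<theta>: "0 < \<theta>" "\<theta> \<le> real (d - 1) / 2" "ennreal \<delta> \<le> ballvol (d - 1) \<theta>"
      "ballvol (d - 1) \<theta> \<le> ennreal ((1 + 1 / real d) ^ (d - 1) * \<delta>)"
  proof -
    have "1 \<le> d - 1" "1 < 1 + 1 / real d" using d2 by auto
    from ballvol_radius_exists[OF this(1) \<delta> this(2)] show ?thesis using that by blast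
  qed
  have \<theta>\<rho>: "4 * \<rho> * real d \<le> \<theta>"
    unfolding \<rho>_def by (rule ballvol_radius_ge[OF d2 K \<delta>K \<theta>(3)])
  define w where "w = \<theta> / (4 * real d * sqrt (real d))"
  have w0: "0 < w" using \<theta> d by (simp add: w_def)
  have w\<rho>: "\<rho> / sqrt (real d) \<le> w"
  proof -
    have "\<rho> / sqrt (real d) = 4 * \<rho> * real d / (4 * real d * sqrt (real d))" using d by simp
    also have "\<dots> \<le> w" unfolding w_def by (intro divide_right_mono \<theta>\<rho>) simp
    finally show ?thesis .
  qed
  have "\<theta> \<le> real d / 2" using \<theta>(2) d2 by simp
  then have "w \<le> real d / 2 / (4 * real d * sqrt (real d))"
    unfolding w_def by (intro divide_right_mono) auto
  have eight: "4 \<le> 8 * sqrt (real d)" using sd by linarith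
  from \<open>w \<le> real d / 2 / (4 * real d * sqrt (real d))\<close> have w8: "w \<le> 1 / (8 * sqrt (real d))" using d by simp
  also have "\<dots> \<le> 1 / 4" by (rule divide_left_mono[OF eight]) (use d in simp_all)
  finally have w4: "w \<le> 1 / 4" .
  define L where "L = nat \<lfloor>1 / (2 * w)\<rfloor>"
  have L: "1 / (4 * w) \<le> real L"
  proof -
    have "2 \<le> 1 / (2 * w)" using w0 w4 by (simp add: field_simps)
    moreover have "1 / (2 * w) = 2 * (1 / (4 * w))" by simp
    ultimately show ?thesis unfolding L_def by linarith
  qed
  \<comment> \<open>A grid so fine that its error (d - 1) / N0 in the radius is at most \<theta> /
    d.\<close>
  obtain N0 :: nat where "real d * real d / \<theta> < real N0" using reals_Archimedean2 by blast
  moreover have "0 < real d * real d / \<theta>" using \<theta> d by simp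
  ultimately have N0: "0 < N0" "real d * real d / \<theta> < real N0" by (simp_all flip: of_nat_0_less_iff)
  define Z where "Z = {..<d} \<rightarrow>\<^sub>E {..<N0}"
  define \<phi> where "\<phi> = bump d M \<theta> N0"
  have Z: "finite Z" "Z \<noteq> {}" "card Z = N0 ^ d"
    using N0(1) by (auto simp: Z_def finite_PiE PiE_eq_empty_iff card_PiE)
  have amp: "amplitude d M i w (\<phi> i z)" for i z
    unfolding w_def \<phi>_def by (rule amplitude_bump[OF M d \<theta>(1)])
  \<comment> \<open>The bump radius and the grid error stay within (1 + 2 / d) \<theta>. This
    dilation costs a factor exp 2 and the overshoot in the choice of \<theta> another factor exp
    1.\<close>
  have supp: "real (card {z \<in> Z. 0 < \<phi> i z x}) \<le> exp 3 * \<delta> * real (card Z)"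
    if i: "i < d" and x: "x \<in> cube d" for i x
  proof -
    define r where "r = \<theta> * (1 + 1 / real d)"
    have c: "0 < M / (8 * sqrt (real d))" using M d by simp
    have in_ball: "torus_dist d i N0 z x \<le> r" if "0 < \<phi> i z x" for z
    proof (rule ccontr)
      assume "\<not> torus_dist d i N0 z x \<le> r"
      then have "M / (8 * sqrt (real d)) * (r - torus_dist d i N0 z x) < 0"
        by (intro mult_pos_neg c) simp
      then show False using that unfolding \<phi>_def bump_def r_def by linarith
    qed
    have "card {z \<in> Z. 0 < \<phi> i z x} \<le> card {z \<in> Z. torus_dist d i N0 z x \<le> r}"
      using Z(1) by (intro card_mono Collect_mono conj_mono in_ball impI) auto
    then have "of_nat (card {z \<in> Z. 0 < \<phi> i z x}) \<le> (of_nat (card {z \<in> Z. torus_dist d i N0 z x \<le> r}) :: ennreal)"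
      by (rule of_nat_mono)
    also have "\<dots> \<le> of_nat (N0 ^ d) * ballvol (d - 1) (r + real (d - 1) / real N0)"
      unfolding Z_def by (rule card_torus_ball_le[OF i N0(1) x])
    also have "ballvol (d - 1) (r + real (d - 1) / real N0) \<le> ballvol (d - 1) ((1 + 2 / real d) * \<theta>)"
    proof (rule ballvol_mono)
      have "real (d - 1) / real N0 \<le> real d / real N0" by (intro divide_right_mono) auto
      also have "\<dots> \<le> \<theta> / real d" using N0 \<theta>(1) d by (simp add: field_simps)
      finally have "real (d - 1) / real N0 \<le> \<theta> / real d" .
      moreover have "(1 + 2 / real d) * \<theta> = r + \<theta> / real d"
        using d by (simp add: r_def field_simps)
      ultimately show "r + real (d - 1) / real N0 \<le> (1 + 2 / real d) * \<theta>" by linarith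
    qed
    also have "\<dots> \<le> ennreal ((1 + 2 / real d) ^ (d - 1)) * ballvol (d - 1) \<theta>"
      by (rule ballvol_scale) simp
    also have "\<dots> \<le> ennreal (exp 2) * ennreal (exp 1 * \<delta>)"
    proof (rule mult_mono)
      show "ennreal ((1 + 2 / real d) ^ (d - 1)) \<le> ennreal (exp 2)"
        by (intro ennreal_leI one_plus_inverse_power_le_exp d) auto
      have "(1 + 1 / real d) ^ (d - 1) * \<delta> \<le> exp 1 * \<delta>"
        by (intro mult_right_mono one_plus_inverse_power_le_exp d) (use \<delta> in auto)
      then show "ballvol (d - 1) \<theta> \<le> ennreal (exp 1 * \<delta>)"
        by (intro order_trans[OF \<theta>(4)] ennreal_leI)
    qed auto
    also have "\<dots> = ennreal (exp 2 * (exp 1 * \<delta>))" using \<delta> by (intro ennreal_mult[symmetric]) auto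
    also have "exp 2 * (exp 1 * \<delta>) = exp 3 * \<delta>" by (simp add: mult_exp_exp flip: mult.assoc)
    finally have "ennreal (real (card {z \<in> Z. 0 < \<phi> i z x})) \<le> ennreal (real (N0 ^ d)) * ennreal (exp 3 * \<delta>)"
      by (simp add: ennreal_of_nat_eq_real_of_nat mult_left_mono)
    also have "\<dots> = ennreal (exp 3 * \<delta> * real (card Z))"
      using \<delta> by (subst ennreal_mult[symmetric]) (auto simp: Z(3) mult_ac)
    finally show ?thesis using \<delta> by (subst (asm) ennreal_le_iff) auto
  qed
  have far: "\<epsilon> \<le> dist_mono1 d (hard d a i (1/4 + real k * w) w (\<phi> i z))"
    if "i < d" "k < L" "z \<in> Z" for a i k z
  proof -
    have "real k + 1 \<le> 1 / (2 * w)" using that(2) w0 by (simp add: L_def) linarith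
    then have "(real k + 1) * w \<le> 1 / 2" using w0 by (simp add: field_simps)
    then have \<zeta>: "1/4 \<le> 1/4 + real k * w" "1/4 + real k * w + w \<le> 3/4" using w0 by (auto simp: algebra_simps)
    have meas: "\<phi> i z \<in> borel_measurable (\<Pi>\<^sub>M j\<in>{..<d}. unit_measure)"
      unfolding \<phi>_def bump_def[abs_def]
      by (intro borel_measurable_max borel_measurable_min borel_measurable_times borel_measurable_diff
          borel_measurable_const torus_dist_borel) auto
    define G :: "(nat \<Rightarrow> real) \<Rightarrow> ennreal" where "G x = indicator {..\<theta>} (torus_dist d i N0 z x)" for x
    have Gm: "G \<in> borel_measurable (\<Pi>\<^sub>M j\<in>I. unit_measure)" if "{..<d} - {i} \<subseteq> I" for I
      unfolding G_def[abs_def] by (rule measurable_compose[OF torus_dist_borel[OF that]]) simp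
    have Gi: "G (x(i := y)) = G x" for x y
    proof -
      have "torus_dist d i N0 z (x(i := y)) = torus_dist d i N0 z x"
        unfolding torus_dist_def by (intro sum.cong) auto
      then show ?thesis by (simp add: G_def)
    qed
    have zN: "0 \<le> real (z j) / real N0 \<and> real (z j) / real N0 \<le> 1" if "j \<in> {..<d} - {i}" for j
      using \<open>z \<in> Z\<close> that N0(1) by (auto simp: Z_def PiE_iff divide_le_eq intro!: less_imp_le)
    \<comment> \<open>The bump has full height on the ball of radius \<theta>, of volume at least
      \<delta>, and the outer half of axis \<open>i\<close> retains half of it.\<close>
    have "ennreal (\<delta> / 2) = ennreal \<delta> / 2" using \<delta> divide_ennreal[of \<delta> 2] by simp
    also have "\<dots> \<le> ballvol (d - 1) \<theta> / 2" by (intro divide_right_mono_ennreal \<theta>)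
    also have "ballvol (d - 1) \<theta> = (\<integral>\<^sup>+x. G x \<partial>(\<Pi>\<^sub>M j\<in>{..<d} - {i}. unit_measure))"
      using nn_integral_ball_indicator[of "{..<d} - {i}" "\<lambda>j. real (z j) / real N0" \<theta>] zN that(1)
      by (simp add: G_def torus_dist_def)
    also have "\<dots> / 2 = (\<integral>\<^sup>+x. G x * indicator ({..1/4} \<union> {3/4..}) (x i) \<partial>(\<Pi>\<^sub>M j\<in>{..<d}. unit_measure))"
      by (rule nn_integral_slab_unit_product[symmetric, OF that(1) Gm Gm Gi]) auto
    also have "\<dots> \<le> (\<integral>\<^sup>+x. indicator {M * w / 2..} (\<phi> i z x) * indicator ({..1/4} \<union> {3/4..}) (x i)
        \<partial>(\<Pi>\<^sub>M j\<in>{..<d}. unit_measure))"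
    proof (intro nn_integral_mono mult_right_mono)
      fix x
      have "M * w / 2 \<le> \<phi> i z x" if "torus_dist d i N0 z x \<le> \<theta>"
      proof -
        have "M / (8 * sqrt (real d)) * (\<theta> / real d)
            \<le> M / (8 * sqrt (real d)) * (\<theta> * (1 + 1 / real d) - torus_dist d i N0 z x)"
          using that M by (intro mult_left_mono) (auto simp: algebra_simps)
        moreover have "M * w / 2 = M / (8 * sqrt (real d)) * (\<theta> / real d)" by (simp add: w_def)
        ultimately show ?thesis unfolding \<phi>_def bump_def by linarith
      qed
      then show "G x \<le> indicator {M * w / 2..} (\<phi> i z x)" by (auto simp: G_def split: split_indicator)
    qed simp
    finally have "M * w * (\<delta> / 2) / 4 \<le> dist_mono1 d (hard d a i (1/4 + real k * w) w (\<phi> i z))"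
      using \<delta> by (intro dist_mono1_hard_ge[OF that(1) M w0 \<zeta> amp meas]) auto
    moreover have "\<epsilon> \<le> M * w * (\<delta> / 2) / 4"
    proof -
      have "\<epsilon> = M * (\<rho> / sqrt (real d)) * (\<delta> / 2) / 4"
        using M \<rho>(1) d by (simp add: \<delta>_def)
      also have "\<dots> \<le> M * w * (\<delta> / 2) / 4"
        using w\<rho> M \<delta> by (intro divide_right_mono mult_right_mono mult_left_mono) auto
      finally show ?thesis .
    qed
    ultimately show ?thesis by linarith
  qed
  have "2 / 3 \<le> real m * ((1 / \<rho> + 14) * (exp 3 * \<delta>) * (4 * w) / sqrt (real d))"
    by (rule tester_samples_ge[where Z=Z and \<phi>=\<phi> and L=L, OF d M w\<rho> w4 \<rho>(1) Z(1,2) amp supp _ L tester])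
       (use far in auto)
  also have "\<dots> \<le> real m * ((1 / \<rho> + 14) * (4 * exp 3 / \<rho>) * \<epsilon> / (M * sqrt (real d)))"
  proof (rule mult_left_mono)
    \<comment> \<open>Here w must be at most of order 1 / sqrt d: it cancels the factor sqrt d in
      \<delta>.\<close>
    have "\<delta> * w \<le> \<delta> * (1 / (8 * sqrt (real d)))" using w8 \<delta> by (intro mult_left_mono) auto
    also have "\<dots> = \<epsilon> / (M * \<rho>)" using d by (simp add: \<delta>_def)
    finally have \<delta>w: "\<delta> * w \<le> \<epsilon> / (M * \<rho>)" .
    define Q where "Q = 1 / \<rho> + 14"
    have "Q * (exp 3 * \<delta>) * (4 * w) / sqrt (real d) = Q * 4 * exp 3 / sqrt (real d) * (\<delta> * w)"
      by (simp add: mult_ac)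
    also have "\<dots> \<le> Q * 4 * exp 3 / sqrt (real d) * (\<epsilon> / (M * \<rho>))"
      using \<rho> by (intro mult_left_mono \<delta>w) (simp add: Q_def)
    also have "\<dots> = Q * (4 * exp 3 / \<rho>) * \<epsilon> / (M * sqrt (real d))"
      by (simp add: mult_ac)
    finally show "(1 / \<rho> + 14) * (exp 3 * \<delta>) * (4 * w) / sqrt (real d)
        \<le> (1 / \<rho> + 14) * (4 * exp 3 / \<rho>) * \<epsilon> / (M * sqrt (real d))"
      unfolding Q_def .
  qed simp
  finally show ?thesis .
qed

text \<open>The constant in \<Omega> is uniform in the dimension and depends only on the rate
  \<open>K\<close>. Bounding \<epsilon> by an absolute fraction of \<open>M\<close> makes the secret
  interval short enough when \<epsilon> is large; the exponential bound on M / \<epsilon> makes the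
  balls have radius of order d when it is small.\<close>

theorem theorem4p2:
  "\<exists>c\<^sub>0>0::real. \<forall>K::real. \<exists>c>0::real.
     \<forall>(d::nat) (M::real) (\<epsilon>::real) (m::nat) (D :: mono_test measure).
       1 \<le> d \<longrightarrow> 0 < M \<longrightarrow> 0 < \<epsilon> \<longrightarrow> \<epsilon> \<le> c\<^sub>0 * M \<longrightarrow> M / \<epsilon> \<le> exp (K * real d) \<longrightarrow>
       L1_derivative_pair_tester d M \<epsilon> m D \<longrightarrow>
       c * (sqrt (real d) * M / \<epsilon>) \<le> real (query_complexity m D)"
proof (rule exI[of _ "1/32"], intro conjI allI)
  fix K :: real
  \<comment> \<open>The case of small \<epsilon> assumes a nonnegative rate; enlarging
    \<open>K\<close> only weakens the bound on M / \<epsilon>.\<close>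
  define K' where "K' = max K 0"
  define \<rho> where "\<rho> = exp (- 2 * (K' + 2)) / 8"
  \<comment> \<open>The constant for small \<epsilon>; it also dominates the one for large
    \<epsilon>.\<close>
  define C where "C = (1 / \<rho> + 14) * (4 * exp 3 / \<rho>)"
  have K': "0 \<le> K'" "K \<le> K'" by (auto simp: K'_def)
  have \<rho>: "0 < \<rho>" "\<rho> \<le> 1 / 8" using K' by (auto simp: \<rho>_def)
  have C: "0 < C" using \<rho> by (simp add: C_def add_pos_pos)
  have C32: "(1 / \<rho> + 14) * 32 \<le> C"
    unfolding C_def
  proof (rule mult_left_mono)
    have "32 * \<rho> \<le> 4 * exp 3" using \<rho> exp_ge_add_one_self[of 3] by linarith
    then show "32 \<le> 4 * exp 3 / \<rho>" using \<rho> by (simp add: le_divide_eq)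
  qed (use \<rho> in simp)
  show "\<exists>c>0. \<forall>d M \<epsilon> m D. 1 \<le> d \<longrightarrow> 0 < M \<longrightarrow> 0 < \<epsilon> \<longrightarrow> \<epsilon> \<le> 1 / 32 * M \<longrightarrow>
       M / \<epsilon> \<le> exp (K * real d) \<longrightarrow> L1_derivative_pair_tester d M \<epsilon> m D \<longrightarrow>
       c * (sqrt (real d) * M / \<epsilon>) \<le> real (query_complexity m D)"
  proof (intro exI[of _ "2 / (3 * C)"] conjI allI impI)
    fix d :: nat and M \<epsilon> :: real and m :: nat and D :: "mono_test measure"
    assume d: "1 \<le> d" and M: "0 < M" and \<epsilon>: "0 < \<epsilon>" "\<epsilon> \<le> 1 / 32 * M"
      and le: "M / \<epsilon> \<le> exp (K * real d)" and tester: "L1_derivative_pair_tester d M \<epsilon> m D"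
    have "2 / 3 \<le> real m * (C * \<epsilon> / (M * sqrt (real d)))"
    \<comment> \<open>At this threshold 8 \<epsilon> / M equals \<rho> / sqrt d and the ball volume
      \<delta> of the other case equals 1.\<close>
    proof (cases "M / \<epsilon> \<le> 8 * sqrt (real d) / \<rho>")
      case True
      have "2 / 3 \<le> real m * ((1 / \<rho> + 14) * 32 * \<epsilon> / (M * sqrt (real d)))"
        by (rule tester_samples_ge_large_eps[OF d M \<epsilon>(1) _ \<rho>(1) True tester]) (use \<epsilon> in simp)
      also have "\<dots> \<le> real m * (C * \<epsilon> / (M * sqrt (real d)))"
        using C32 M \<epsilon> by (intro mult_left_mono divide_right_mono mult_right_mono) auto
      finally show ?thesis .
    next
      case False
      have "exp (K * real d) \<le> exp (K' * real d)" using K' by (simp add: mult_right_mono)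
      with le have "M / \<epsilon> \<le> exp (K' * real d)" by linarith
      from tester_samples_ge_small_eps[OF K'(1) d M \<epsilon>(1) _ this tester] False
      show ?thesis by (simp add: C_def \<rho>_def)
    qed
    also have "\<dots> = real m * C / (sqrt (real d) * M / \<epsilon>)" by (simp add: mult_ac)
    finally have "2 / 3 \<le> real m * C / (sqrt (real d) * M / \<epsilon>)" .
    moreover have "0 < sqrt (real d) * M / \<epsilon>" using d M \<epsilon> by simp
    ultimately have "2 / 3 * (sqrt (real d) * M / \<epsilon>) \<le> real m * C" by (simp only: pos_le_divide_eq)
    then have "2 / 3 * (sqrt (real d) * M / \<epsilon>) / C \<le> real m" using C by (simp only: pos_divide_le_eq)
    then have "2 / (3 * C) * (sqrt (real d) * M / \<epsilon>) \<le> real m" by (simp add: mult_ac)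
    also have "real m \<le> real (query_complexity m D)"
      using tester le_query_complexity[of D m]
      by (simp add: L1_derivative_pair_tester_def test_distribution_def)
    finally show "2 / (3 * C) * (sqrt (real d) * M / \<epsilon>) \<le> real (query_complexity m D)" .
  qed (use C in simp)
qed simp

end
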